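(* For a smooth function $f=f(x,y)$ on $\mathbb{R}^2$ let $\mathcal{M}_f=(\mathbb{R}^3,g_f)$ be the Lorentzian manifold with coordinates $(x,y,\tilde x)$ and metric whose (possibly) non-zero components are $g_f(\partial_x,\partial_x)=-2f(x,y)$, $g_f(\partial_x,\partial_{\tilde x})=g_f(\partial_y,\partial_y)=1$. (1) Let $k$ be a positive integer. There exists $f_k$ so that $\mathcal{M}_{f_k}$ is variable $k$-curvature homogeneous but not variable $(k+1)$-curvature homogeneous. (2) The manifold $\mathcal{M}_{\frac12e^xy^2}$ is variable $k$-curvature homogeneous for all $k$, but is not homothety $1$-curvature homogeneous and hence not locally homogeneous. (3) Consider the following four properties of a pseudo-Riemannian manifold $\mathcal{M}$ of dimension at least $3$: (1a) $k$-curvature homogeneous; (1b) homothety $k$-curvature homogeneous; (2a) variable $k$-curvature homogeneous; (2b) variable homothety $k$-curvature homogeneous. Then the following implications hold: $$(1a)\Rightarrow(1b)\Rightarrow(2b)\quad\text{and}\quad(1a)\Rightarrow(2a)\Rightarrow(2b)\,.$$ All other possible implications between these four properties are false, i.e. none of $(1b)\Rightarrow(1a)$, $(2a)\Rightarrow(1a)$, $(2b)\Rightarrow(1a)$, $(2a)\Rightarrow(1b)$, $(2b)\Rightarrow(1b)$, $(1b)\Rightarrow(2a)$, $(2b)\Rightarrow(2a)$ is valid in general (for all $\mathcal{M}$ and all $k$).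
   Context: For a pseudo-Riemannian manifold $\mathcal{M}=(M,g)$, $R$ is the $(0,4)$ curvature tensor of the Levi-Civita connection and $\nabla^\ell R\in\otimes^{\ell+4}T^*M$ is its $\ell$-th covariant derivative. $\mathcal{M}$ is locally homogeneous if for any $P,Q\in M$ there is an isometry from a neighborhood of $P$ onto a neighborhood of $Q$ sending $P$ to $Q$. A $k$-curvature model is a tuple $\mathfrak{M}_k=(V,\langle\cdot,\cdot\rangle,A_0,\dots,A_k)$ where $\langle\cdot,\cdot\rangle$ is a non-degenerate inner product on a finite-dimensional real vector space $V$ and $A_\ell\in\otimes^{4+\ell}V^*$. The manifold $\mathcal{M}$ is said to be: (1a) $k$-curvature homogeneous if there is a model $\mathfrak{M}_k$ such that for every $P\in M$ there exists a linear isometry $\phi_P:T_PM\to V$ with $\phi_P^*A_\ell=\nabla^\ell R_P$ for $0\le\ell\le k$; (1b) homothety $k$-curvature homogeneous if there is a model $\mathfrak{M}_k$ such that for every $P\in M$ there exist a linear isometry $\phi_P:T_PM\to V$ and a scaling factor $0\neq\lambda=\lambda_P\in\mathbb{R}$ with $\phi_P^*A_\ell=\lambda^{2+\ell}\nabla^\ell R_P$ for $0\le\ell\le k$; (2a) variable $k$-curvature homogeneous if there is a model $\mathfrak{M}_k$ such that for every $P\in M$ and every $0\le\ell\le k$ there exists a linear isometry $\phi_{P,\ell}:T_PM\to V$ with $\phi_{P,\ell}^*A_\ell=\nabla^\ell R_P$; (2b) variable homothety $k$-curvature homogeneous if there is a model $\mathfrak{M}_k$ such that for every $P\in M$ and every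 $0\le\ell\le k$ there exist a linear isometry $\phi_{P,\ell}:T_PM\to V$ and a scaling factor $0\ne\lambda_\ell=\lambda_{P,\ell}\in\mathbb{R}$ with $\phi_{P,\ell}^*A_\ell=\lambda_\ell^{2+\ell}\nabla^\ell R_P$. *)

theory Defs
  imports "HOL-Analysis.Analysis"
begin

section \<open>Smooth maps and tensors on open subsets of a vector space\<close>

text \<open>Only used for open sets \<open>S\<close>: all iterated directional derivatives exist and are continuous.\<close>

primrec Ck_on :: "nat \<Rightarrow> 'v set \<Rightarrow> ('v::real_normed_vector \<Rightarrow> 'w::real_normed_vector) \<Rightarrow> bool" where
  "Ck_on 0 S f = continuous_on S f"
| "Ck_on (Suc k) S f =
     (f differentiable_on S \<and> (\<forall>v. Ck_on k S (\<lambda>x. frechet_derivative f (at x) v)))"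

definition smooth_on :: "'v set \<Rightarrow> ('v::real_normed_vector \<Rightarrow> 'w::real_normed_vector) \<Rightarrow> bool" where
  "smooth_on S f \<longleftrightarrow> (\<forall>k. Ck_on k S f)"

text \<open>A covariant tensor of rank \<open>r\<close> is a function of the list of its \<open>r\<close> arguments; its values on
  lists of any other length are irrelevant.\<close>

type_synonym 'v tensor = "'v list \<Rightarrow> real"

definition multilinear_form :: "nat \<Rightarrow> 'v::real_vector tensor \<Rightarrow> bool" where
  "multilinear_form r A \<longleftrightarrow> (\<forall>vs i. length vs = r \<and> i < r \<longrightarrow> linear (\<lambda>u. A (vs[i := u])))"

definition inner_product :: "('v::real_vector \<Rightarrow> 'v \<Rightarrow> real) \<Rightarrow> bool" where
  "inner_product b \<longleftrightarrow>
     bilinear b \<and> (\<forall>u v. b u v = b v u) \<and> (\<forall>u. (\<forall>v. b u v = 0) \<longrightarrow> u = 0)"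


section \<open>Levi-Civita connection and curvature in coordinates\<close>

text \<open>A metric in coordinates is a map \<open>g\<close> assigning to each point \<open>x\<close> a bilinear form \<open>g x\<close>.
  Vectors are regarded as coordinate (constant) vector fields; their brackets vanish, and
  \<open>levi_civita g x u v\<close> is the value at \<open>x\<close> of the covariant derivative of \<open>v\<close> along \<open>u\<close>.
  The second conjunct says that the connection is torsion-free, the third that it is metric.\<close>

type_synonym 'v metric_field = "'v \<Rightarrow> 'v \<Rightarrow> 'v \<Rightarrow> real"

definition levi_civita :: "'v::euclidean_space metric_field \<Rightarrow> 'v \<Rightarrow> 'v \<Rightarrow> 'v \<Rightarrow> 'v" where
  "levi_civita g x = (THE \<Gamma>. bilinear \<Gamma> \<and> (\<forall>u v. \<Gamma> u v = \<Gamma> v u) \<and>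
     (\<forall>w u v. frechet_derivative (\<lambda>y. g y u v) (at x) w = g x (\<Gamma> w u) v + g x u (\<Gamma> w v)))"

text \<open>The curvature operator \<open>R(u,v)w = \<nabla>\<^sub>u\<nabla>\<^sub>v w - \<nabla>\<^sub>v\<nabla>\<^sub>u w\<close> on coordinate fields, where
  \<open>\<nabla>\<^sub>u X = D\<^sub>u X + \<Gamma> u X\<close>, and the \<open>(0,4)\<close> tensor \<open>g(R(u,v)w,z)\<close>.\<close>

definition curvature_operator ::
    "'v::euclidean_space metric_field \<Rightarrow> 'v \<Rightarrow> 'v \<Rightarrow> 'v \<Rightarrow> 'v \<Rightarrow> 'v" where
  "curvature_operator g x u v w = (let \<Gamma> = levi_civita g in
     frechet_derivative (\<lambda>y. \<Gamma> y v w) (at x) u + \<Gamma> x u (\<Gamma> x v w)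
     - (frechet_derivative (\<lambda>y. \<Gamma> y u w) (at x) v + \<Gamma> x v (\<Gamma> x u w)))"

definition curvature_tensor :: "'v::euclidean_space metric_field \<Rightarrow> 'v \<Rightarrow> 'v tensor" where
  "curvature_tensor g x vs =
     g x (curvature_operator g x (vs ! 0) (vs ! 1) (vs ! 2)) (vs ! 3)"

text \<open>Covariant derivative of a tensor field; the direction of differentiation is the last
  argument.\<close>

definition nabla :: "('v \<Rightarrow> 'v \<Rightarrow> 'v \<Rightarrow> 'v) \<Rightarrow> ('v \<Rightarrow> 'v tensor) \<Rightarrow> 'v::euclidean_space \<Rightarrow> 'v tensor" where
  "nabla \<Gamma> T x vs = (let us = butlast vs; w = last vs in
     frechet_derivative (\<lambda>y. T y us) (at x) w
     - (\<Sum>i<length us. T x (us[i := \<Gamma> x w (us ! i)])))"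

primrec nabla_curvature :: "'v::euclidean_space metric_field \<Rightarrow> nat \<Rightarrow> 'v \<Rightarrow> 'v tensor" where
  "nabla_curvature g 0 = curvature_tensor g"
| "nabla_curvature g (Suc l) = nabla (levi_civita g) (nabla_curvature g l)"


section \<open>Pseudo-Riemannian manifolds\<close>

text \<open>A chart is a domain together with a coordinate map, of which only the values on the domain
  matter. The atlas need not be maximal. The metric is given by its coordinate expression in each
  chart of the atlas. The dimension of the manifold is that of the model space \<open>'v\<close>.\<close>

type_synonym ('a, 'v) chart = "'a set \<times> ('a \<Rightarrow> 'v)"

record ('a, 'v) prm =
  mtop :: "'a topology"
  atlas :: "('a, 'v) chart set"
  mmetric :: "('a, 'v) chart \<Rightarrow> 'v metric_field"

definition charts_at :: "('a, 'v) prm \<Rightarrow> 'a \<Rightarrow> ('a, 'v) chart set" where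
  "charts_at M p = {c \<in> atlas M. p \<in> fst c}"

definition local_rep :: "('a, 'v) chart \<Rightarrow> ('a, 'v) chart \<Rightarrow> ('a \<Rightarrow> 'a) \<Rightarrow> 'v \<Rightarrow> 'v" where
  "local_rep c d h = snd d \<circ> h \<circ> inv_into (fst c) (snd c)"

definition local_deriv ::
    "('a, 'v::euclidean_space) chart \<Rightarrow> ('a, 'v) chart \<Rightarrow> ('a \<Rightarrow> 'a) \<Rightarrow> 'a \<Rightarrow> 'v \<Rightarrow> 'v" where
  "local_deriv c d h p = frechet_derivative (local_rep c d h) (at (snd c p))"

definition smooth_map :: "('a, 'v::euclidean_space) prm \<Rightarrow> 'a set \<Rightarrow> ('a \<Rightarrow> 'a) \<Rightarrow> bool" where
  "smooth_map M U h \<longleftrightarrow> (\<forall>c\<in>atlas M. \<forall>d\<in>atlas M.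
     smooth_on (snd c ` {p \<in> U \<inter> fst c. h p \<in> fst d}) (local_rep c d h))"

definition preserves_metric :: "('a, 'v::euclidean_space) prm \<Rightarrow> 'a set \<Rightarrow> ('a \<Rightarrow> 'a) \<Rightarrow> bool" where
  "preserves_metric M U h \<longleftrightarrow>
     (\<forall>p\<in>U. \<forall>c\<in>charts_at M p. \<forall>d\<in>charts_at M (h p). \<forall>u v.
        mmetric M d (snd d (h p)) (local_deriv c d h p u) (local_deriv c d h p v)
        = mmetric M c (snd c p) u v)"

text \<open>For \<open>h = id\<close>, the last two conditions below say that the transition maps are smooth and that
  the coordinate expressions of the metric transform as a tensor.\<close>

definition pseudo_riemannian_manifold :: "('a, 'v::euclidean_space) prm \<Rightarrow> bool" where
  "pseudo_riemannian_manifold M \<longleftrightarrow>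
     Hausdorff_space (mtop M) \<and> second_countable (mtop M) \<and>
     \<Union> (fst ` atlas M) = topspace (mtop M) \<and>
     (\<forall>c\<in>atlas M. openin (mtop M) (fst c) \<and> open (snd c ` fst c) \<and>
        homeomorphic_map (subtopology (mtop M) (fst c)) (top_of_set (snd c ` fst c)) (snd c)) \<and>
     (\<forall>c\<in>atlas M. \<forall>u v. smooth_on (snd c ` fst c) (\<lambda>x. mmetric M c x u v)) \<and>
     (\<forall>c\<in>atlas M. \<forall>x\<in>snd c ` fst c. inner_product (mmetric M c x)) \<and>
     smooth_map M (topspace (mtop M)) id \<and>
     preserves_metric M (topspace (mtop M)) id"

text \<open>A tangent vector at \<open>p\<close> is the family of its coordinate vectors in the charts around \<open>p\<close>,
  subject to the transformation rule (and extended by \<open>0\<close> to the other charts); it is determined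
  by any one of its members. The vector space operations are the pointwise ones.\<close>

type_synonym ('a, 'v) tangent = "('a, 'v) chart \<Rightarrow> 'v"

definition tangent_space :: "('a, 'v::euclidean_space) prm \<Rightarrow> 'a \<Rightarrow> ('a, 'v) tangent set" where
  "tangent_space M p = {v.
     (\<forall>c. c \<notin> charts_at M p \<longrightarrow> v c = 0) \<and>
     (\<forall>c\<in>charts_at M p. \<forall>d\<in>charts_at M p. v d = local_deriv c d id p (v c))}"

text \<open>Tensors at \<open>p\<close> are evaluated in an arbitrary chart around \<open>p\<close>; being tensors, they do not
  depend on its choice.\<close>

definition chart_of :: "('a, 'v) prm \<Rightarrow> 'a \<Rightarrow> ('a, 'v) chart" where
  "chart_of M p = (SOME c. c \<in> charts_at M p)"

definition metric_at ::
    "('a, 'v::euclidean_space) prm \<Rightarrow> 'a \<Rightarrow> ('a, 'v) tangent \<Rightarrow> ('a, 'v) tangent \<Rightarrow> real" where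
  "metric_at M p v w = (let c = chart_of M p in mmetric M c (snd c p) (v c) (w c))"

definition nabla_R_at ::
    "('a, 'v::euclidean_space) prm \<Rightarrow> nat \<Rightarrow> 'a \<Rightarrow> ('a, 'v) tangent tensor" where
  "nabla_R_at M l p vs = (let c = chart_of M p in
     nabla_curvature (mmetric M c) l (snd c p) (map (\<lambda>v. v c) vs))"

definition locally_homogeneous :: "('a, 'v::euclidean_space) prm \<Rightarrow> bool" where
  "locally_homogeneous M \<longleftrightarrow> (\<forall>p\<in>topspace (mtop M). \<forall>q\<in>topspace (mtop M). \<exists>U V h.
     openin (mtop M) U \<and> openin (mtop M) V \<and> p \<in> U \<and> q \<in> V \<and> h p = q \<and>
     homeomorphic_map (subtopology (mtop M) U) (subtopology (mtop M) V) h \<and>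
     smooth_map M U h \<and> smooth_map M V (inv_into U h) \<and> preserves_metric M U h)"


section \<open>Curvature models and the notions of curvature homogeneity\<close>

text \<open>The vector space of a model is taken to be the model space \<open>'v\<close> of the manifold: a linear
  isometry from a tangent space forces its dimension to be that of \<open>'v\<close>.\<close>

definition curvature_model ::
    "nat \<Rightarrow> ('v::euclidean_space \<Rightarrow> 'v \<Rightarrow> real) \<Rightarrow> (nat \<Rightarrow> 'v tensor) \<Rightarrow> bool" where
  "curvature_model k b A \<longleftrightarrow> inner_product b \<and> (\<forall>l\<le>k. multilinear_form (4 + l) (A l))"

definition linear_isometry ::
    "('a, 'v::euclidean_space) prm \<Rightarrow> 'a \<Rightarrow> ('v \<Rightarrow> 'v \<Rightarrow> real) \<Rightarrow> (('a, 'v) tangent \<Rightarrow> 'v) \<Rightarrow> bool"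
  where
  "linear_isometry M p b \<phi> \<longleftrightarrow>
     bij_betw \<phi> (tangent_space M p) UNIV \<and>
     (\<forall>v\<in>tangent_space M p. \<forall>w\<in>tangent_space M p. \<phi> (\<lambda>c. v c + w c) = \<phi> v + \<phi> w) \<and>
     (\<forall>r. \<forall>v\<in>tangent_space M p. \<phi> (\<lambda>c. r *\<^sub>R v c) = r *\<^sub>R \<phi> v) \<and>
     (\<forall>v\<in>tangent_space M p. \<forall>w\<in>tangent_space M p. b (\<phi> v) (\<phi> w) = metric_at M p v w)"

text \<open>\<open>\<phi>\<^sup>* A = \<mu> \<nabla>\<^sup>l R\<close> at \<open>p\<close>, for \<open>A\<close> of rank \<open>4 + l\<close>.\<close>

definition pulls_back ::
    "('a, 'v::euclidean_space) prm \<Rightarrow> nat \<Rightarrow> 'a \<Rightarrow> (('a, 'v) tangent \<Rightarrow> 'v) \<Rightarrow> 'v tensor \<Rightarrow> real \<Rightarrow> bool"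
  where
  "pulls_back M l p \<phi> A \<mu> \<longleftrightarrow>
     (\<forall>vs. length vs = 4 + l \<and> set vs \<subseteq> tangent_space M p \<longrightarrow>
        A (map \<phi> vs) = \<mu> * nabla_R_at M l p vs)"

definition curvature_homogeneous :: "nat \<Rightarrow> ('a, 'v::euclidean_space) prm \<Rightarrow> bool" where
  "curvature_homogeneous k M \<longleftrightarrow> (\<exists>b A. curvature_model k b A \<and>
     (\<forall>p\<in>topspace (mtop M). \<exists>\<phi>. linear_isometry M p b \<phi> \<and>
        (\<forall>l\<le>k. pulls_back M l p \<phi> (A l) 1)))"

definition homothety_curvature_homogeneous :: "nat \<Rightarrow> ('a, 'v::euclidean_space) prm \<Rightarrow> bool" where
  "homothety_curvature_homogeneous k M \<longleftrightarrow> (\<exists>b A. curvature_model k b A \<and>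
     (\<forall>p\<in>topspace (mtop M). \<exists>\<phi> s. linear_isometry M p b \<phi> \<and> s \<noteq> 0 \<and>
        (\<forall>l\<le>k. pulls_back M l p \<phi> (A l) (s ^ (2 + l)))))"

definition variable_curvature_homogeneous :: "nat \<Rightarrow> ('a, 'v::euclidean_space) prm \<Rightarrow> bool" where
  "variable_curvature_homogeneous k M \<longleftrightarrow> (\<exists>b A. curvature_model k b A \<and>
     (\<forall>p\<in>topspace (mtop M). \<forall>l\<le>k. \<exists>\<phi>. linear_isometry M p b \<phi> \<and>
        pulls_back M l p \<phi> (A l) 1))"

definition variable_homothety_curvature_homogeneous ::
    "nat \<Rightarrow> ('a, 'v::euclidean_space) prm \<Rightarrow> bool" where
  "variable_homothety_curvature_homogeneous k M \<longleftrightarrow> (\<exists>b A. curvature_model k b A \<and>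
     (\<forall>p\<in>topspace (mtop M). \<forall>l\<le>k. \<exists>\<phi> s. linear_isometry M p b \<phi> \<and> s \<noteq> 0 \<and>
        pulls_back M l p \<phi> (A l) (s ^ (2 + l))))"


section \<open>The Lorentzian manifolds determined by a function of two variables\<close>

text \<open>The coordinates \<open>x, y, x~\<close> are the components \<open>1, 2, 3\<close> of a point.\<close>

definition metric_f :: "(real \<times> real \<Rightarrow> real) \<Rightarrow> (real ^ 3) metric_field" where
  "metric_f f p u v =
     - 2 * f (p $ 1, p $ 2) * u $ 1 * v $ 1 + u $ 1 * v $ 3 + u $ 3 * v $ 1 + u $ 2 * v $ 2"

definition manifold_f :: "(real \<times> real \<Rightarrow> real) \<Rightarrow> (real ^ 3, real ^ 3) prm" where
  "manifold_f f = \<lparr>mtop = euclidean, atlas = {(UNIV, id)}, mmetric = (\<lambda>_. metric_f f)\<rparr>"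

end

(*  For a plane wave f = a(x) y^2 / 2 one has
      nabla^l R = - a^(l)(x) (dx /\ dy) (x) (dx /\ dy) (x) dx^l    ("(x)" is the tensor product),
    because dx and dx /\ dy are parallel.  The boost dx -> s dx multiplies this tensor by s^(l+2), so
    each level can be normalised separately as long as a^(l) > 0; this gives variable homogeneity,
    and a zero of a^(k+1) destroys it at level k+1.  For a = exp the levels 0 and 1 cannot be
    normalised by the same boost, even up to homothety, since s^2 exp x and s^3 exp x cannot both be
    constant.  Moreover, a local isometry h satisfies D^2 h = J Gamma - Gamma(J, J); the
    integrability conditions of this system force h to preserve the coordinate x.

    The cone metric exp (2 x) (dx^2 + dy^2 + dz^2) has transitive homotheties but non-constant
    curvature, so it is homothety but not variable 0-curvature homogeneous. *)
theory Submission
  imports Defs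
begin

text \<open>Failure of local homogeneity is not deduced from failure of homothety homogeneity at
  level 1: that would need the invariance of the curvature and of its covariant derivative under
  local isometries. The isometry equation itself is differentiated instead. It makes the Jacobian J
  of h satisfy an equation that expresses dJ through h and J alone, and whenever an entry of J has a
  differential of the form G dx, the mixed second derivatives force G to be independent of y.
  Symmetry of second derivatives is thus the one analytic tool, used both to derive the system and
  to exploit it; it is proved in a pointwise form, so that no continuity of second derivatives has
  to be supplied.

  The curvature side is pure linear algebra. The unknown model is eliminated by comparing two points
  through it, and the rest is about what linear isometries do to an explicit tensor.\<close>

section \<open>Symmetry of second derivatives\<close>

text \<open>The mean value theorem is applied along \<open>w\<close> only, so the estimate needs no more than
  differentiability of the first derivative at \<open>p\<close>; exchanging \<open>u\<close> and \<open>w\<close> then gives symmetry.\<close>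

lemma second_difference_approx:
  fixes f :: "'v::real_normed_vector \<Rightarrow> real"
  assumes U: "open U" "p \<in> U" and f: "\<And>x. x \<in> U \<Longrightarrow> (f has_derivative f' x) (at x)"
    and f'': "((\<lambda>x. f' x w) has_derivative B) (at p)" and "e > 0"
  shows "\<exists>d>0. \<forall>t. 0 < t \<and> t < d \<longrightarrow>
    \<bar>f (p + t *\<^sub>R w + t *\<^sub>R u) - f (p + t *\<^sub>R w) - f (p + t *\<^sub>R u) + f p - t\<^sup>2 * B u\<bar>
      \<le> e * t\<^sup>2"
proof -
  \<comment> \<open>Strictly larger than \<open>norm w + norm u\<close>, so that the parallelogram
    with sides \<open>t *\<^sub>R w\<close> and \<open>t *\<^sub>R u\<close> stays within distance
    \<open>t * n\<close> of \<open>p\<close>.\<close>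
  define n where "n = norm w + norm u + 1"
  have n: "n > 0" "norm w < n" "norm u < n" and nn: "norm w + norm u < n"
    by (auto simp: n_def add_nonneg_pos add_pos_nonneg intro: le_less_trans)
  interpret B: linear B by (rule has_derivative_linear[OF f''])
  obtain r where r: "r > 0" "ball p r \<subseteq> U" using U open_contains_ball by blast
  \<comment> \<open>The linear approximation is used at two points, each with error
    \<open>e' * (t * n)\<close>, and the mean value theorem contributes another factor
    \<open>t\<close>; the total is \<open>e * t\<^sup>2\<close>.\<close>
  define e' where "e' = e / (2 * n)"
  have e': "e' > 0" using \<open>e > 0\<close> n by (simp add: e'_def)
  obtain d where d: "d > 0" and
    dd: "\<And>y. norm (y - p) < d \<Longrightarrow> \<bar>f' y w - f' p w - B (y - p)\<bar> \<le> e' * norm (y - p)"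
    using f'' e' unfolding has_derivative_at_alt by (auto simp: real_norm_def)
  have "\<bar>f (p + t *\<^sub>R w + t *\<^sub>R u) - f (p + t *\<^sub>R w) - f (p + t *\<^sub>R u) + f p - t\<^sup>2 * B u\<bar> \<le> e * t\<^sup>2"
    if t: "0 < t" "t < min d r / n" for t
  proof -
    have tn: "t * n < d" "t * n < r" using t n by (auto simp: field_simps)
    have sm: "norm (s *\<^sub>R w + q *\<^sub>R u) \<le> t * n" if "0 \<le> s" "s \<le> t" "0 \<le> q" "q \<le> t" for s q
    proof -
      have "norm (s *\<^sub>R w + q *\<^sub>R u) \<le> s * norm w + q * norm u"
        using norm_triangle_ineq[of "s *\<^sub>R w" "q *\<^sub>R u"] that by simp
      also have "\<dots> \<le> t * norm w + t * norm u"
        using that by (intro add_mono mult_right_mono) auto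
      also have "\<dots> \<le> t * n" using t nn by (simp flip: distrib_left)
      finally show ?thesis .
    qed
    have inU: "p + s *\<^sub>R w + q *\<^sub>R u \<in> U" if "0 \<le> s" "s \<le> t" "0 \<le> q" "q \<le> t" for s q
      using sm[OF that] tn norm_minus_cancel[of "s *\<^sub>R w + q *\<^sub>R u"]
      by (intro r(2)[THEN subsetD]) (simp add: dist_norm algebra_simps)
    \<comment> \<open>The term \<open>0 *\<^sub>R u\<close> is written out so that both summands are
      instances of the same facts \<open>D\<close> and \<open>est\<close>, with \<open>q = t\<close>
      and \<open>q = 0\<close>.\<close>
    define \<phi> where "\<phi> s = f (p + s *\<^sub>R w + t *\<^sub>R u) - f (p + s *\<^sub>R w + 0 *\<^sub>R u)" for s
    have D: "((\<lambda>s. f (p + s *\<^sub>R w + q *\<^sub>R u)) has_real_derivative f' (p + s *\<^sub>R w + q *\<^sub>R u) w) (at s)"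
      if "0 \<le> s" "s \<le> t" "0 \<le> q" "q \<le> t" for s q
    proof -
      have "((\<lambda>s. p + s *\<^sub>R w + q *\<^sub>R u) has_derivative (\<lambda>h. h *\<^sub>R w)) (at s)"
        by (auto intro!: derivative_eq_intros)
      from has_derivative_compose[OF this f[OF inU[OF that]]]
      have "((\<lambda>s. f (p + s *\<^sub>R w + q *\<^sub>R u)) has_derivative (\<lambda>h. f' (p + s *\<^sub>R w + q *\<^sub>R u) (h *\<^sub>R w))) (at s)" .
      moreover have "(\<lambda>h. f' (p + s *\<^sub>R w + q *\<^sub>R u) (h *\<^sub>R w)) = (*) (f' (p + s *\<^sub>R w + q *\<^sub>R u) w)"
        using linear_scale[OF has_derivative_linear[OF f[OF inU[OF that]]]] by (auto simp: mult.commute)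
      ultimately show ?thesis by (simp add: has_field_derivative_def)
    qed
    have "\<exists>z. 0 < z \<and> z < t \<and> \<phi> t - \<phi> 0 =
       (t - 0) * (f' (p + z *\<^sub>R w + t *\<^sub>R u) w - f' (p + z *\<^sub>R w + 0 *\<^sub>R u) w)"
      by (rule MVT2[OF t(1)], unfold \<phi>_def, intro DERIV_diff D) (use t in simp_all)
    then obtain z where z: "0 < z" "z < t" "\<phi> t - \<phi> 0 =
       t * (f' (p + z *\<^sub>R w + t *\<^sub>R u) w - f' (p + z *\<^sub>R w + 0 *\<^sub>R u) w)" by auto
    have est: "\<bar>f' (p + z *\<^sub>R w + q *\<^sub>R u) w - f' p w - (z * B w + q * B u)\<bar> \<le> e' * (t * n)"
      if "0 \<le> q" "q \<le> t" for q
    proof -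
      have s: "norm (z *\<^sub>R w + q *\<^sub>R u) \<le> t * n" using z that by (intro sm) auto
      have "\<bar>f' (p + z *\<^sub>R w + q *\<^sub>R u) w - f' p w - B (z *\<^sub>R w + q *\<^sub>R u)\<bar> \<le> e' * norm (z *\<^sub>R w + q *\<^sub>R u)"
        using dd[of "p + z *\<^sub>R w + q *\<^sub>R u"] s tn by (simp add: add.assoc)
      also have "\<dots> \<le> e' * (t * n)" using s e' by simp
      finally show ?thesis by (simp add: B.add B.scale)
    qed
    have "\<bar>f' (p + z *\<^sub>R w + t *\<^sub>R u) w - f' (p + z *\<^sub>R w + 0 *\<^sub>R u) w - t * B u\<bar> \<le> 2 * e' * (t * n)"
      using est[of t] est[of 0] t by simp
    then have "\<bar>\<phi> t - \<phi> 0 - t * (t * B u)\<bar> \<le> t * (2 * e' * (t * n))"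
      unfolding z(3) using t by (simp add: abs_mult flip: right_diff_distrib)
    also have "\<dots> = e * t\<^sup>2" using n by (simp add: e'_def power2_eq_square)
    finally show ?thesis by (simp add: \<phi>_def power2_eq_square algebra_simps)
  qed
  then show ?thesis using d r n by (intro exI[of _ "min d r / n"]) auto
qed

lemma second_derivative_symmetric:
  fixes f :: "'v::real_normed_vector \<Rightarrow> real"
  assumes U: "open U" "p \<in> U" and f: "\<And>x. x \<in> U \<Longrightarrow> (f has_derivative f' x) (at x)"
    and f'': "\<And>v. ((\<lambda>x. f' x v) has_derivative f'' v) (at p)"
  shows "f'' u w = f'' w u"
proof (rule ccontr)
  assume ne: "f'' u w \<noteq> f'' w u"
  \<comment> \<open>The two estimates differ by at most \<open>2 * e * t\<^sup>2\<close>, so a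
    quarter of the supposed discrepancy is small enough for a contradiction.\<close>
  define e where "e = \<bar>f'' u w - f'' w u\<bar> / 4"
  have e: "e > 0" using ne by (simp add: e_def)
  obtain d where d: "d > 0" "\<And>t. 0 < t \<and> t < d \<Longrightarrow>
    \<bar>f (p + t *\<^sub>R w + t *\<^sub>R u) - f (p + t *\<^sub>R w) - f (p + t *\<^sub>R u) + f p - t\<^sup>2 * f'' w u\<bar> \<le> e * t\<^sup>2"
    using second_difference_approx[OF U f f'' e, where u=u] by blast
  obtain d' where d': "d' > 0" "\<And>t. 0 < t \<and> t < d' \<Longrightarrow>
    \<bar>f (p + t *\<^sub>R u + t *\<^sub>R w) - f (p + t *\<^sub>R u) - f (p + t *\<^sub>R w) + f p - t\<^sup>2 * f'' u w\<bar> \<le> e * t\<^sup>2"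
    using second_difference_approx[OF U f f'' e, where u=w] by blast
  obtain t where t: "0 < t" "t < d" "t < d'" using d(1) d'(1) field_lbound_gt_zero by blast
  have "\<bar>t\<^sup>2 * f'' u w - t\<^sup>2 * f'' w u\<bar> \<le> 2 * (e * t\<^sup>2)"
    using d(2)[of t] d'(2)[of t] t by (simp add: add.assoc add.commute[of "t *\<^sub>R u"])
  moreover have "\<bar>t\<^sup>2 * f'' u w - t\<^sup>2 * f'' w u\<bar> = \<bar>f'' u w - f'' w u\<bar> * t\<^sup>2"
    by (metis abs_mult abs_power2 mult.commute right_diff_distrib)
  ultimately have "\<bar>f'' u w - f'' w u\<bar> * t\<^sup>2 \<le> (2 * e) * t\<^sup>2" by simp
  then have "\<bar>f'' u w - f'' w u\<bar> \<le> 2 * e"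
    by (rule mult_right_le_imp_le) (use t in simp)
  then show False using ne by (simp add: e_def)
qed

section \<open>Smooth functions\<close>

lemma Ck_on_SucD: "Ck_on (Suc k) S f \<Longrightarrow> Ck_on k S f"
  by (induction k arbitrary: f) (auto intro: differentiable_imp_continuous_on)

lemma Ck_on_const: "Ck_on k UNIV (\<lambda>x. c)"
  by (induction k arbitrary: c) (auto simp: differentiable_on_def)

lemma Ck_on_bounded_linear:
  assumes "bounded_linear f" shows "Ck_on k UNIV f"
proof (cases k)
  case (Suc j)
  have "frechet_derivative f (at x) = f" for x
    using frechet_derivative_at[OF bounded_linear.has_derivative[OF assms has_derivative_ident]] by simp
  then show ?thesis using assms Suc
    by (auto simp: bounded_linear_imp_differentiable_on Ck_on_const)
qed (use assms in \<open>simp add: linear_continuous_on\<close>)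

lemma has_frechet_derivative_UNIV: "f differentiable_on UNIV \<Longrightarrow> (f has_derivative frechet_derivative f (at x)) (at x)"
  by (simp add: differentiable_on_def frechet_derivative_works)

lemma Ck_on_add:
  "Ck_on k UNIV f \<Longrightarrow> Ck_on k UNIV g \<Longrightarrow> Ck_on k UNIV (\<lambda>x. f x + g x)"
proof (induction k arbitrary: f g)
  case (Suc k)
  then have "frechet_derivative (\<lambda>x. f x + g x) (at x) =
    (\<lambda>v. frechet_derivative f (at x) v + frechet_derivative g (at x) v)" for x
    by (intro frechet_derivative_at[symmetric] has_derivative_add has_frechet_derivative_UNIV) auto
  with Suc show ?case by auto
qed (simp add: continuous_on_add)

lemma Ck_on_mult:
  fixes f g :: "'v::real_normed_vector \<Rightarrow> real"
  shows "Ck_on k UNIV f \<Longrightarrow> Ck_on k UNIV g \<Longrightarrow> Ck_on k UNIV (\<lambda>x. f x * g x)"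
proof (induction k arbitrary: f g)
  case (Suc k)
  have D: "frechet_derivative (\<lambda>x. f x * g x) (at x) =
    (\<lambda>v. f x * frechet_derivative g (at x) v + frechet_derivative f (at x) v * g x)" for x
    using Suc.prems by (intro frechet_derivative_at[symmetric] has_derivative_mult has_frechet_derivative_UNIV) auto
  have "Ck_on k UNIV f" "Ck_on k UNIV g" using Suc.prems by (auto intro: Ck_on_SucD)
  then show ?case
    using Suc by (auto simp: D intro!: Ck_on_add)
qed (simp add: continuous_on_mult)

lemma Ck_on_exp: "bounded_linear l \<Longrightarrow> Ck_on k UNIV (\<lambda>x. exp (l x :: real))"
proof (induction k)
  case 0
  then show ?case by (simp add: linear_continuous_on continuous_on_exp)
next
  case (Suc k)
  have d: "((\<lambda>x. exp (l x)) has_derivative (\<lambda>v. exp (l x) * l v)) (at x)" for x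
    using bounded_linear.has_derivative[OF Suc.prems has_derivative_ident, of "at x"]
    by (auto intro!: derivative_eq_intros)
  show ?case using Suc d frechet_derivative_at[OF d, symmetric]
    by (auto simp: differentiable_on_def differentiable_def intro!: Ck_on_mult Ck_on_const)
qed

lemma smooth_on_const: "smooth_on UNIV (\<lambda>x. c)"
  and smooth_on_bounded_linear: "bounded_linear l \<Longrightarrow> smooth_on UNIV l"
  and smooth_on_add: "smooth_on UNIV f \<Longrightarrow> smooth_on UNIV g \<Longrightarrow> smooth_on UNIV (\<lambda>x. f x + g x)"
  by (simp_all add: smooth_on_def Ck_on_const Ck_on_bounded_linear Ck_on_add)

lemma smooth_on_mult:
  fixes f g :: "'v::real_normed_vector \<Rightarrow> real"
  shows "smooth_on UNIV f \<Longrightarrow> smooth_on UNIV g \<Longrightarrow> smooth_on UNIV (\<lambda>x. f x * g x)"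
  by (simp add: smooth_on_def Ck_on_mult)

lemma smooth_on_exp: "bounded_linear l \<Longrightarrow> smooth_on UNIV (\<lambda>x. exp (l x :: real))"
  by (simp add: smooth_on_def Ck_on_exp)

section \<open>Manifolds with a global chart\<close>

text \<open>The two transpositions compose to a 3-cycle that changes the sign of \<open>S\<close>.
  Its third power is the identity, whence \<open>S = - S\<close>. This lies behind both the
  uniqueness of the Levi-Civita connection and its invariance under isometries.\<close>

lemma symmetric_skew_form_zero:
  fixes S :: "'a \<Rightarrow> 'a \<Rightarrow> 'a \<Rightarrow> real"
  assumes "\<And>u v w. S u v w = S v u w" and "\<And>u v w. S u v w = - S u w v"
  shows "S u v w = 0"
proof -
  have "S u v w = - S u v w" using assms by metis
  then show ?thesis by simp
qed

text \<open>The difference of two torsion-free metric connections is symmetric in its first two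
  slots and skew in the last two, hence zero. So a guessed connection only has to be
  verified.\<close>

lemma levi_civita_eqI:
  assumes "inner_product (g x)" and "bilinear \<Gamma>" and "\<And>u v. \<Gamma> u v = \<Gamma> v u"
    and "\<And>u v. ((\<lambda>y. g y u v) has_derivative (\<lambda>w. g x (\<Gamma> w u) v + g x u (\<Gamma> w v))) (at x)"
  shows "levi_civita g x = \<Gamma>"
  unfolding levi_civita_def
proof (rule the_equality)
  have D: "frechet_derivative (\<lambda>y. g y u v) (at x) w = g x (\<Gamma> w u) v + g x u (\<Gamma> w v)" for u v w
    using frechet_derivative_at[OF assms(4), symmetric] by simp
  with assms show "bilinear \<Gamma> \<and> (\<forall>u v. \<Gamma> u v = \<Gamma> v u) \<and>
     (\<forall>w u v. frechet_derivative (\<lambda>y. g y u v) (at x) w = g x (\<Gamma> w u) v + g x u (\<Gamma> w v))"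
    by simp
  fix \<Gamma>' assume \<Gamma>': "bilinear \<Gamma>' \<and> (\<forall>u v. \<Gamma>' u v = \<Gamma>' v u) \<and>
     (\<forall>w u v. frechet_derivative (\<lambda>y. g y u v) (at x) w = g x (\<Gamma>' w u) v + g x u (\<Gamma>' w v))"
  have g: "bilinear (g x)" and sym: "g x u v = g x v u" for u v
    using assms(1) by (auto simp: inner_product_def)
  have "g x (\<Gamma>' u v - \<Gamma> u v) w = 0" for u v w
  proof (rule symmetric_skew_form_zero[where S = "\<lambda>u v w. g x (\<Gamma>' u v - \<Gamma> u v) w"])
    show "g x (\<Gamma>' u v - \<Gamma> u v) w = g x (\<Gamma>' v u - \<Gamma> v u) w" for u v w
      using \<Gamma>' assms(3) by metis
    show "g x (\<Gamma>' u v - \<Gamma> u v) w = - g x (\<Gamma>' u w - \<Gamma> u w) v" for u v w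
      using \<Gamma>' D[of v w u] sym[of v] by (simp add: bilinear_lsub[OF g])
  qed
  then have "\<Gamma>' u v - \<Gamma> u v = 0" for u v
    using assms(1) unfolding inner_product_def by blast
  then show "\<Gamma>' = \<Gamma>" by (simp add: fun_eq_iff)
qed

text \<open>A common form for the plane waves and the cone: with a single chart, tangent vectors and
  tensors reduce to coordinate vectors and their coordinate expressions.\<close>

definition global_chart :: "'v::euclidean_space metric_field \<Rightarrow> ('v, 'v) prm" where
  "global_chart g = \<lparr>mtop = euclidean, atlas = {(UNIV, id)}, mmetric = (\<lambda>_. g)\<rparr>"

lemma global_chart_simps [simp]:
  "mtop (global_chart g) = euclidean" "atlas (global_chart g) = {(UNIV, id)}"
  "mmetric (global_chart g) c = g" "charts_at (global_chart g) p = {(UNIV, id)}"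
  "chart_of (global_chart g) p = (UNIV, id)"
  by (auto simp: global_chart_def charts_at_def chart_of_def)

lemma local_rep_UNIV_id [simp]: "local_rep (UNIV, id) (UNIV, id) h = h"
  by (simp add: local_rep_def inv_id[unfolded id_def] id_def fun_eq_iff)

lemma local_deriv_UNIV_id [simp]: "local_deriv (UNIV, id) (UNIV, id) id p = id"
  unfolding local_deriv_def local_rep_UNIV_id
  using frechet_derivative_at[OF has_derivative_ident, of "snd (UNIV, id) p"]
  by (simp add: id_def)

lemma manifold_f_eq: "manifold_f f = global_chart (metric_f f)"
  by (simp add: manifold_f_def global_chart_def)

lemma pseudo_riemannian_global_chart:
  assumes "\<And>u v. smooth_on UNIV (\<lambda>x. g x u v)" and "\<And>x. inner_product (g x)"
    and id: "smooth_on UNIV (id :: 'v \<Rightarrow> 'v)"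
  shows "pseudo_riemannian_manifold (global_chart (g :: 'v::euclidean_space metric_field))"
proof -
  have "homeomorphic_map (top_of_set (UNIV::'v set)) (top_of_set UNIV) id"
    by (simp only: homeomorphic_map_id)
  moreover have "second_countable (euclidean :: 'v topology)"
  proof -
    obtain \<B> :: "'v set set" where "countable \<B>" "\<And>C. C \<in> \<B> \<Longrightarrow> open C"
      "\<And>S. open S \<Longrightarrow> \<exists>\<U>. \<U> \<subseteq> \<B> \<and> S = \<Union>\<U>"
      using univ_second_countable by blast
    then show ?thesis unfolding second_countable_def open_openin[symmetric]
      by (intro exI[of _ \<B>]) (metis Union_iff Union_upper subsetD)
  qed
  ultimately show ?thesis using assms Hausdorff_space_euclidean
    unfolding pseudo_riemannian_manifold_def smooth_map_def preserves_metric_def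
    by simp
qed

section \<open>Tangent vectors and linear isometries in coordinates\<close>

definition coord_tangent :: "'v \<Rightarrow> ('v, 'v::euclidean_space) tangent" where
  "coord_tangent u = (\<lambda>c. if c = (UNIV, id) then u else 0)"

lemma coord_tangent_apply [simp]: "coord_tangent u (UNIV, id) = u"
  by (simp add: coord_tangent_def)

lemma tangent_space_global_chart: "tangent_space (global_chart g) p = range coord_tangent"
proof (intro set_eqI iffI)
  fix v assume "v \<in> tangent_space (global_chart g) p"
  then have "v = coord_tangent (v (UNIV, id))"
    by (auto simp: tangent_space_def coord_tangent_def)
  then show "v \<in> range coord_tangent" by blast
qed (auto simp: tangent_space_def coord_tangent_def split: if_splits)

text \<open>The coordinate counterpart of \<open>linear_isometry\<close>. Source and target are both
  forms on the model space, so that isometries between two points can be composed and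
  inverted.\<close>

definition form_isometry ::
    "('v::euclidean_space \<Rightarrow> 'v \<Rightarrow> real) \<Rightarrow> ('v \<Rightarrow> 'v \<Rightarrow> real) \<Rightarrow> ('v \<Rightarrow> 'v) \<Rightarrow> bool" where
  "form_isometry b b' L \<longleftrightarrow> linear L \<and> bij L \<and> (\<forall>u v. b' (L u) (L v) = b u v)"

text \<open>A vector in the kernel of \<open>L\<close> lies in the radical of \<open>b\<close>, so
  \<open>L\<close> is injective; finite dimension makes it surjective.\<close>

lemma form_isometryI:
  assumes "inner_product b" "inner_product b'" "linear L" "\<And>u v. b' (L u) (L v) = b u v"
  shows "form_isometry b b' L"
proof -
  have "u = 0" if "L u = 0" for u
  proof -
    have "b u v = 0" for v
      using assms(4)[of u v] that assms(2) by (simp add: inner_product_def bilinear_lzero)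
    then show ?thesis using assms(1) unfolding inner_product_def by blast
  qed
  then have "inj L" using assms(3) by (simp add: linear_injective_0)
  with linear_injective_imp_surjective[OF assms(3)] assms(3,4) show ?thesis
    by (simp add: form_isometry_def bij_def)
qed

lemma linear_isometry_global_chartI:
  assumes "form_isometry (g p) b L"
  shows "linear_isometry (global_chart g) p b (\<lambda>v. L (v (UNIV, id)))"
proof -
  have "bij_betw (\<lambda>v. v (UNIV, id)) (range coord_tangent) UNIV"
    by (rule bij_betw_byWitness[where f' = coord_tangent]) auto
  moreover have "bij L" using assms by (simp add: form_isometry_def)
  ultimately have "bij_betw (\<lambda>v. L (v (UNIV, id))) (range coord_tangent) UNIV"
    using bij_betw_trans[of "\<lambda>v. v (UNIV, id)" _ UNIV L UNIV] by (simp add: comp_def)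
  with assms show ?thesis
    by (auto simp: linear_isometry_def tangent_space_global_chart form_isometry_def
        metric_at_def linear_add linear_scale)
qed

lemma linear_isometry_global_chartD:
  fixes g :: "'v::euclidean_space metric_field"
  assumes "linear_isometry (global_chart g) p b \<phi>"
  shows "form_isometry (g p) b (\<phi> \<circ> coord_tangent)"
proof -
  have \<phi>: "bij_betw \<phi> (range coord_tangent) UNIV"
    "\<And>u v. \<phi> (\<lambda>c. coord_tangent u c + coord_tangent v c) = \<phi> (coord_tangent u) + \<phi> (coord_tangent v)"
    "\<And>r u. \<phi> (\<lambda>c. r *\<^sub>R coord_tangent u c) = r *\<^sub>R \<phi> (coord_tangent u)"
    "\<And>u v. b (\<phi> (coord_tangent u)) (\<phi> (coord_tangent v)) = g p u v"
    using assms by (simp_all add: linear_isometry_def tangent_space_global_chart metric_at_def)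
  have "inj coord_tangent"
    by (rule inj_on_inverseI[where g = "\<lambda>v. v (UNIV, id)"]) simp
  then have "bij (\<phi> \<circ> coord_tangent)"
    by (intro bij_betw_trans[OF _ \<phi>(1)] inj_on_imp_bij_betw)
  moreover have "coord_tangent (u + v) = (\<lambda>c. coord_tangent u c + coord_tangent v c)"
    "coord_tangent (r *\<^sub>R u) = (\<lambda>c. r *\<^sub>R coord_tangent u c)" for u v :: 'v and r
    by (auto simp: coord_tangent_def fun_eq_iff)
  then have "linear (\<phi> \<circ> coord_tangent)"
    by (intro linearI) (simp_all only: comp_apply \<phi>)
  ultimately show ?thesis using \<phi>(4) by (simp add: form_isometry_def)
qed

lemma pulls_back_global_chart_iff:
  fixes g :: "'v::euclidean_space metric_field"
  shows "pulls_back (global_chart g) l p \<phi> A \<mu> \<longleftrightarrow> (\<forall>us. length us = 4 + l \<longrightarrow>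
     A (map (\<phi> \<circ> coord_tangent) us) = \<mu> * nabla_curvature g l p us)"
proof -
  have "(\<forall>vs. length vs = 4 + l \<and> set vs \<subseteq> range coord_tangent \<longrightarrow> P vs) \<longleftrightarrow>
    (\<forall>us. length us = 4 + l \<longrightarrow> P (map coord_tangent (us :: 'v list)))" for P
  proof (intro iffI allI impI)
    fix vs :: "('v, 'v) tangent list" assume P: "\<forall>us. length us = 4 + l \<longrightarrow> P (map coord_tangent (us :: 'v list))"
      and vs: "length vs = 4 + l \<and> set vs \<subseteq> range coord_tangent"
    from vs have "\<exists>us :: 'v list. vs = map coord_tangent us"
      unfolding ex_map_conv by blast
    then obtain us :: "'v list" where "vs = map coord_tangent us" ..
    with P vs show "P vs" by auto
  next
    fix us :: "'v list"
    assume P: "\<forall>vs. length vs = 4 + l \<and> set vs \<subseteq> range coord_tangent \<longrightarrow> P vs" and "length us = 4 + l"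
    then show "P (map coord_tangent us)"
      by (intro P[rule_format]) auto
  qed
  from this[of "\<lambda>vs. A (map \<phi> vs) = \<mu> * nabla_R_at (global_chart g) l p vs"] show ?thesis
    by (simp add: pulls_back_def tangent_space_global_chart nabla_R_at_def comp_def)
qed

text \<open>Going into the model at \<open>p\<close> and back at \<open>q\<close> removes the
  unknown \<open>b\<close> and \<open>A\<close>. The map \<open>L\<close> is fixed before the level
  \<open>l\<close>, as the homothety notion requires one isometry for all levels.\<close>

lemma form_isometry_between:
  fixes g :: "'v::euclidean_space metric_field"
  assumes p: "linear_isometry (global_chart g) p b \<phi>" and q: "linear_isometry (global_chart g) q b \<psi>"
  obtains L where "form_isometry (g p) (g q) L"
    "\<And>l A s t us. pulls_back (global_chart g) l p \<phi> A s \<Longrightarrow> pulls_back (global_chart g) l q \<psi> A t \<Longrightarrow>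
       length us = 4 + l \<Longrightarrow> t * nabla_curvature g l q (map L us) = s * nabla_curvature g l p us"
proof
  define F where "F = \<phi> \<circ> coord_tangent"
  define G where "G = \<psi> \<circ> coord_tangent"
  have F: "form_isometry (g p) b F" and G: "form_isometry (g q) b G"
    using p q by (simp_all add: F_def G_def linear_isometry_global_chartD)
  have GF: "G (inv G (F u)) = F u" for u
    using G by (simp add: form_isometry_def bij_is_surj surj_f_inv_f)
  have "linear (inv G)"
    using G by (simp add: form_isometry_def inj_linear_imp_inv_linear bij_is_inj)
  moreover have "g q (inv G (F u)) (inv G (F v)) = g p u v" for u v
    using F G GF unfolding form_isometry_def by metis
  ultimately show "form_isometry (g p) (g q) (inv G \<circ> F)"
    using F G by (auto simp: form_isometry_def linear_compose bij_comp bij_imp_bij_inv)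
  fix l A s t and us :: "'v list"
  assume "pulls_back (global_chart g) l p \<phi> A s" "pulls_back (global_chart g) l q \<psi> A t"
    and l: "length us = 4 + l"
  then have "A (map F us) = s * nabla_curvature g l p us"
    and "\<And>vs. length vs = 4 + l \<Longrightarrow> A (map G vs) = t * nabla_curvature g l q vs"
    unfolding pulls_back_global_chart_iff F_def[symmetric] G_def[symmetric] by auto
  from this(1) this(2)[of "map (inv G \<circ> F) us"] l
  have "A (map F us) = s * nabla_curvature g l p us"
    "A (map G (map (inv G \<circ> F) us)) = t * nabla_curvature g l q (map (inv G \<circ> F) us)"
    by simp_all
  moreover have "map G (map (inv G \<circ> F) us) = map F us" using GF by (simp add: comp_def)
  ultimately show "t * nabla_curvature g l q (map (inv G \<circ> F) us) = s * nabla_curvature g l p us"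
    by metis
qed

section \<open>Criteria for the homogeneity notions in coordinates\<close>

lemma variable_curvature_homogeneous_global_chartI:
  assumes "curvature_model k b A"
    and "\<And>p l. l \<le> k \<Longrightarrow> \<exists>L. form_isometry (g p) b L \<and>
      (\<forall>us. length us = 4 + l \<longrightarrow> A l (map L us) = nabla_curvature g l p us)"
  shows "variable_curvature_homogeneous k (global_chart g)"
  unfolding variable_curvature_homogeneous_def
proof (rule exI[of _ b], rule exI[of _ A], intro conjI ballI allI impI)
  fix p l assume "p \<in> topspace (mtop (global_chart g))" "l \<le> k"
  then obtain L where L: "form_isometry (g p) b L"
    "\<forall>us. length us = 4 + l \<longrightarrow> A l (map L us) = nabla_curvature g l p us" using assms(2) by blast
  have "(\<lambda>v. L (v (UNIV, id))) \<circ> coord_tangent = L" by auto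
  with L have "pulls_back (global_chart g) l p (\<lambda>v. L (v (UNIV, id))) (A l) 1"
    by (simp add: pulls_back_global_chart_iff)
  with linear_isometry_global_chartI[where g=g and p=p, OF L(1)]
  show "\<exists>\<phi>. linear_isometry (global_chart g) p b \<phi> \<and> pulls_back (global_chart g) l p \<phi> (A l) 1"
    by blast
qed (rule assms(1))

lemma homothety_curvature_homogeneous_global_chartI:
  assumes "curvature_model k b A"
    and "\<And>p. \<exists>L s. form_isometry (g p) b L \<and> s \<noteq> 0 \<and> (\<forall>l\<le>k.
      \<forall>us. length us = 4 + l \<longrightarrow> A l (map L us) = s ^ (2 + l) * nabla_curvature g l p us)"
  shows "homothety_curvature_homogeneous k (global_chart g)"
  unfolding homothety_curvature_homogeneous_def
proof (rule exI[of _ b], rule exI[of _ A], intro conjI ballI)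
  fix p assume "p \<in> topspace (mtop (global_chart g))"
  obtain L s where L: "form_isometry (g p) b L" "s \<noteq> 0" "\<forall>l\<le>k.
    \<forall>us. length us = 4 + l \<longrightarrow> A l (map L us) = s ^ (2 + l) * nabla_curvature g l p us"
    using assms(2) by blast
  have "(\<lambda>v. L (v (UNIV, id))) \<circ> coord_tangent = L" by auto
  with L have "\<forall>l\<le>k. pulls_back (global_chart g) l p (\<lambda>v. L (v (UNIV, id))) (A l) (s ^ (2 + l))"
    by (simp add: pulls_back_global_chart_iff)
  with linear_isometry_global_chartI[where g=g and p=p, OF L(1)] L(2)
  show "\<exists>\<phi> s. linear_isometry (global_chart g) p b \<phi> \<and> s \<noteq> 0 \<and>
      (\<forall>l\<le>k. pulls_back (global_chart g) l p \<phi> (A l) (s ^ (2 + l)))"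
    by blast
qed (rule assms(1))

lemma variable_curvature_homogeneous_global_chartD:
  assumes "variable_curvature_homogeneous k (global_chart g)" and "l \<le> k"
  obtains L where "form_isometry (g p) (g q) L"
    "\<And>us. length us = 4 + l \<Longrightarrow> nabla_curvature g l q (map L us) = nabla_curvature g l p us"
proof -
  have "p \<in> topspace (mtop (global_chart g))" "q \<in> topspace (mtop (global_chart g))" by simp_all
  with assms obtain b A \<phi> \<psi> where
    *: "linear_isometry (global_chart g) p b \<phi>" "linear_isometry (global_chart g) q b \<psi>"
    and **: "pulls_back (global_chart g) l p \<phi> (A l) 1" "pulls_back (global_chart g) l q \<psi> (A l) 1"
    unfolding variable_curvature_homogeneous_def by blast
  obtain L where "form_isometry (g p) (g q) L" and
    "\<And>l A s t us. pulls_back (global_chart g) l p \<phi> A s \<Longrightarrow> pulls_back (global_chart g) l q \<psi> A t \<Longrightarrow>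
       length us = 4 + l \<Longrightarrow> t * nabla_curvature g l q (map L us) = s * nabla_curvature g l p us"
    using form_isometry_between[OF *] by blast
  from this(1) this(2)[OF **] show thesis by (intro that) simp_all
qed

lemma homothety_curvature_homogeneous_global_chartD:
  assumes "homothety_curvature_homogeneous k (global_chart g)"
  obtains L s t where "form_isometry (g p) (g q) L" "s \<noteq> 0" "t \<noteq> 0"
    "\<And>l us. l \<le> k \<Longrightarrow> length us = 4 + l \<Longrightarrow>
      t ^ (2 + l) * nabla_curvature g l q (map L us) = s ^ (2 + l) * nabla_curvature g l p us"
proof -
  have "p \<in> topspace (mtop (global_chart g))" "q \<in> topspace (mtop (global_chart g))" by simp_all
  with assms obtain b A \<phi> \<psi> s t where
    *: "linear_isometry (global_chart g) p b \<phi>" "linear_isometry (global_chart g) q b \<psi>" and st: "s \<noteq> 0" "t \<noteq> 0"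
    and **: "\<And>l. l \<le> k \<Longrightarrow> pulls_back (global_chart g) l p \<phi> (A l) (s ^ (2 + l))"
    "\<And>l. l \<le> k \<Longrightarrow> pulls_back (global_chart g) l q \<psi> (A l) (t ^ (2 + l))"
    unfolding homothety_curvature_homogeneous_def by blast
  obtain L where "form_isometry (g p) (g q) L" and
    "\<And>l A s t us. pulls_back (global_chart g) l p \<phi> A s \<Longrightarrow> pulls_back (global_chart g) l q \<psi> A t \<Longrightarrow>
       length us = 4 + l \<Longrightarrow> t * nabla_curvature g l q (map L us) = s * nabla_curvature g l p us"
    using form_isometry_between[OF *] by blast
  from this(1) st this(2)[OF **] show thesis by (rule that)
qed

section \<open>Plane waves\<close>

lemma metric_f_simp: "metric_f f p u v =
  - 2 * f (p $ 1, p $ 2) * u $ 1 * v $ 1 + u $ 1 * v $ 3 + u $ 3 * v $ 1 + u $ 2 * v $ 2"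
  by (simp add: metric_f_def)

lemma inner_product_metric_f: "inner_product (metric_f f p)"
proof -
  have "u = 0" if "\<forall>v. metric_f f p u v = 0" for u
    using that[rule_format, of "axis 1 1"] that[rule_format, of "axis 2 1"] that[rule_format, of "axis 3 1"]
    by (simp add: metric_f_def axis_def vec_eq_iff forall_3)
  moreover have "bilinear (metric_f f p)"
    by (auto simp: bilinear_def metric_f_def algebra_simps intro!: linearI)
  ultimately show ?thesis by (auto simp: inner_product_def metric_f_def)
qed

definition plane_wave :: "(real \<Rightarrow> real) \<Rightarrow> real \<times> real \<Rightarrow> real" where
  "plane_wave a = (\<lambda>(x, y). 1 / 2 * a x * y ^ 2)"

text \<open>The Christoffel symbols for f = a(x) y^2 / 2: the pair (e1, e1) goes to f_y e2 - f_x e3,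
  and the pair (e1, e2) to - f_y e3, where f_x = a' y^2 / 2 and f_y = a y.\<close>

definition wave_connection ::
    "(real \<Rightarrow> real) \<Rightarrow> (real \<Rightarrow> real) \<Rightarrow> real ^ 3 \<Rightarrow> real ^ 3 \<Rightarrow> real ^ 3 \<Rightarrow> real ^ 3" where
  "wave_connection a a' p u v =
     (a (p $ 1) * p $ 2 * u $ 1 * v $ 1) *\<^sub>R axis 2 1
     - (a' (p $ 1) * (p $ 2)\<^sup>2 * u $ 1 * v $ 1 / 2 + a (p $ 1) * p $ 2 * (u $ 1 * v $ 2 + u $ 2 * v $ 1))
       *\<^sub>R axis 3 1"

lemma wave_connection_nth [simp]:
  "wave_connection a a' p u v $ 1 = 0"
  "wave_connection a a' p u v $ 2 = a (p $ 1) * p $ 2 * u $ 1 * v $ 1"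
  "wave_connection a a' p u v $ 3 =
     - (a' (p $ 1) * (p $ 2)\<^sup>2 * u $ 1 * v $ 1 / 2 + a (p $ 1) * p $ 2 * (u $ 1 * v $ 2 + u $ 2 * v $ 1))"
  by (simp_all add: wave_connection_def axis_def)

lemma has_derivative_nth [derivative_intros]:
  "(f has_derivative f') F \<Longrightarrow> ((\<lambda>x. f x $ i) has_derivative (\<lambda>h. f' h $ i)) F"
  by (rule bounded_linear.has_derivative[OF bounded_linear_vec_nth])

text \<open>Metric compatibility for vector fields along a map \<open>h\<close>. For
  \<open>h\<close> the identity and constant vectors it identifies the Levi-Civita connection; for
  \<open>h\<close> an isometry and columns of its Jacobian it differentiates the isometry
  equation.\<close>

lemma has_derivative_plane_wave_metric:
  assumes "(a has_real_derivative a' (h p $ 1)) (at (h p $ 1))"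
    and h: "(h has_derivative h') (at p)" and "(U has_derivative U') (at p)" "(V has_derivative V') (at p)"
  shows "((\<lambda>x. metric_f (plane_wave a) (h x) (U x) (V x)) has_derivative
    (\<lambda>w. metric_f (plane_wave a) (h p) (U' w + wave_connection a a' (h p) (h' w) (U p)) (V p)
       + metric_f (plane_wave a) (h p) (U p) (V' w + wave_connection a a' (h p) (h' w) (V p)))) (at p)"
proof -
  have "((\<lambda>x. a (h x $ 1)) has_derivative (\<lambda>w. h' w $ 1 * a' (h p $ 1))) (at p)"
    using assms(1) has_derivative_nth[OF h] by (rule DERIV_compose_FDERIV)
  then show ?thesis unfolding metric_f_simp plane_wave_def prod.case
    by (auto intro!: derivative_eq_intros assms(2-) simp: fun_eq_iff) (simp add: field_simps power2_eq_square)
qed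

lemma bilinear_wave_connection: "bilinear (wave_connection a a' p)"
  by (auto simp: bilinear_def vec_eq_iff forall_3 algebra_simps add_divide_distrib intro!: linearI)

lemma wave_connection_commute: "wave_connection a a' p u v = wave_connection a a' p v u"
  by (auto simp: vec_eq_iff forall_3 algebra_simps)

lemma levi_civita_plane_wave:
  assumes "\<And>x. (a has_real_derivative a' x) (at x)"
  shows "levi_civita (metric_f (plane_wave a)) = wave_connection a a'"
proof
  fix p
  have "((\<lambda>y. metric_f (plane_wave a) y u v) has_derivative
    (\<lambda>w. metric_f (plane_wave a) p (wave_connection a a' p w u) v
       + metric_f (plane_wave a) p u (wave_connection a a' p w v))) (at p)" for u v
    using has_derivative_plane_wave_metric[where a = a and a' = a' and h = "\<lambda>x. x" and p = p
        and U = "\<lambda>_. u" and V = "\<lambda>_. v", OF assms has_derivative_ident has_derivative_const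
        has_derivative_const] by simp
  then show "levi_civita (metric_f (plane_wave a)) p = wave_connection a a' p"
    by (intro levi_civita_eqI inner_product_metric_f bilinear_wave_connection)
      (rule wave_connection_commute)
qed

definition area_form :: "real ^ 3 \<Rightarrow> real ^ 3 \<Rightarrow> real" where
  "area_form u v = u $ 1 * v $ 2 - u $ 2 * v $ 1"

text \<open>The derivative slots start at index 4 because \<open>nabla\<close> appends the direction
  of differentiation; the minus sign matches the convention of
  \<open>curvature_tensor\<close>.\<close>

definition wave_tensor :: "nat \<Rightarrow> (real ^ 3) tensor" where
  "wave_tensor l vs = - (area_form (vs ! 0) (vs ! 1) * area_form (vs ! 2) (vs ! 3))
     * (\<Prod>i\<in>{4..<4 + l}. vs ! i $ 1)"

lemma curvature_tensor_plane_wave: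
  assumes a: "\<And>x. (a has_real_derivative a' x) (at x)" and a': "\<And>x. (a' has_real_derivative a'' x) (at x)"
  shows "curvature_tensor (metric_f (plane_wave a)) p vs = a (p $ 1) * wave_tensor 0 vs"
proof -
  have d: "((\<lambda>y. a (y $ 1)) has_derivative (\<lambda>w. w $ 1 * a' (p $ 1))) (at p)"
    "((\<lambda>y. a' (y $ 1)) has_derivative (\<lambda>w. w $ 1 * a'' (p $ 1))) (at p)"
    using DERIV_compose_FDERIV[OF a has_derivative_nth[OF has_derivative_ident]]
      DERIV_compose_FDERIV[OF a' has_derivative_nth[OF has_derivative_ident]] by auto
  have "((\<lambda>y. wave_connection a a' y u v) has_derivative
    (\<lambda>w. (w $ 1 * a' (p $ 1) * p $ 2 * u $ 1 * v $ 1 + a (p $ 1) * w $ 2 * u $ 1 * v $ 1) *\<^sub>R axis 2 1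
     - (w $ 1 * a'' (p $ 1) * (p $ 2)\<^sup>2 * u $ 1 * v $ 1 / 2 + a' (p $ 1) * p $ 2 * w $ 2 * u $ 1 * v $ 1
        + (w $ 1 * a' (p $ 1) * p $ 2 + a (p $ 1) * w $ 2) * (u $ 1 * v $ 2 + u $ 2 * v $ 1)) *\<^sub>R axis 3 1)) (at p)"
    for u v
    unfolding wave_connection_def
    by (auto intro!: derivative_eq_intros d simp: fun_eq_iff)
      (simp add: vec_eq_iff forall_3 axis_def field_simps power2_eq_square)
  note D = frechet_derivative_at[OF this, symmetric]
  show ?thesis
    unfolding curvature_tensor_def curvature_operator_def Let_def levi_civita_plane_wave[OF a] D
      metric_f_simp wave_tensor_def area_form_def
    by (simp add: axis_def algebra_simps)
qed

lemma wave_tensor_skew: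
  assumes us: "length us = 4 + l" and "\<And>u. G u $ 1 = 0" "\<And>u. G u $ 2 = c * u $ 1"
  shows "(\<Sum>i<length us. wave_tensor l (us[i := G (us ! i)])) = 0"
proof -
  have "wave_tensor l (us[i := G (us ! i)]) = 0" if i: "i \<in> {4..<4 + l}" for i
  proof -
    have "(\<Prod>j\<in>{4..<4 + l}. us[i := G (us ! i)] ! j $ 1) = 0"
      by (rule prod_zero) (use i us assms(2) in \<open>auto intro!: bexI[of _ i]\<close>)
    then show ?thesis unfolding wave_tensor_def by simp
  qed
  then have "(\<Sum>i\<in>{4..<4 + l}. wave_tensor l (us[i := G (us ! i)])) = 0" by simp
  moreover have "(\<Sum>i<4. wave_tensor l (us[i := G (us ! i)])) = 0"
  proof -
    define P where "P = (\<Prod>i\<in>{4..<4 + l}. us ! i $ 1)"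
    have W: "wave_tensor l (us[i := x]) = - (area_form (us[i := x] ! 0) (us[i := x] ! 1)
        * area_form (us[i := x] ! 2) (us[i := x] ! 3)) * P" if "i < 4" for i x
      using that by (simp add: wave_tensor_def P_def)
    have "{..<4} = {0, 1, 2, 3::nat}" by auto
    then show ?thesis using us assms(2,3) by (simp add: W) (simp add: area_form_def algebra_simps)
  qed
  moreover have "{..<length us} = {..<4} \<union> {4..<4 + l}" using us by auto
  ultimately show ?thesis by (simp add: sum.union_disjoint ivl_disj_int)
qed

text \<open>The forms \<open>dx\<close> and \<open>dx \<and> dy\<close> are parallel, so that only the coefficient is differentiated.\<close>

lemma nabla_curvature_plane_wave:
  assumes d: "\<And>l x. (d l has_real_derivative d (Suc l) x) (at x)" and "length vs = 4 + l"
  shows "nabla_curvature (metric_f (plane_wave (d 0))) l p vs = d l (p $ 1) * wave_tensor l vs"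
  using assms(2)
proof (induction l arbitrary: p vs)
  case 0
  then show ?case using curvature_tensor_plane_wave[OF d d] by simp
next
  case (Suc l)
  define us w where "us = butlast vs" and "w = last vs"
  have "vs \<noteq> []" using Suc.prems by auto
  then have vs: "vs = us @ [w]" and us: "length us = 4 + l"
    using Suc.prems by (simp_all add: us_def w_def)
  have "((\<lambda>y. d l (y $ 1) * wave_tensor l us) has_derivative
      (\<lambda>w. w $ 1 * d (Suc l) (p $ 1) * wave_tensor l us)) (at p)"
    using DERIV_compose_FDERIV[OF d has_derivative_nth[OF has_derivative_ident]]
    by (auto intro!: derivative_eq_intros)
  note D = frechet_derivative_at[OF this, symmetric]
  have "nabla_curvature (metric_f (plane_wave (d 0))) (Suc l) p vs =
    w $ 1 * d (Suc l) (p $ 1) * wave_tensor l us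
    - d l (p $ 1) * (\<Sum>i<length us. wave_tensor l (us[i := wave_connection (d 0) (d 1) p w (us ! i)]))"
    using us by (simp add: nabla_def Let_def vs Suc.IH D levi_civita_plane_wave[OF d] sum_distrib_left)
  also have "\<dots> = w $ 1 * d (Suc l) (p $ 1) * wave_tensor l us"
    by (subst wave_tensor_skew[OF us, where c = "d 0 (p $ 1) * p $ 2 * w $ 1"]) auto
  also have "\<dots> = d (Suc l) (p $ 1) * wave_tensor (Suc l) vs"
  proof -
    have "{4..<4 + Suc l} = insert (4 + l) {4..<4 + l}" by auto
    moreover have "(\<Prod>i\<in>{4..<4 + l}. vs ! i $ 1) = (\<Prod>i\<in>{4..<4 + l}. us ! i $ 1)"
      by (intro prod.cong) (auto simp: vs us nth_append)
    moreover have "vs ! (4 + l) = w" "vs ! 0 = us ! 0" "vs ! 1 = us ! 1" "vs ! 2 = us ! 2" "vs ! 3 = us ! 3"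
      using us by (simp_all add: vs nth_append)
    ultimately show ?thesis by (simp add: wave_tensor_def)
  qed
  finally show ?case .
qed

lemma multilinear_wave_tensor: "multilinear_form (4 + l) (wave_tensor l)"
  unfolding multilinear_form_def
proof (intro allI impI)
  fix vs :: "(real ^ 3) list" and i
  assume i: "length vs = 4 + l \<and> i < 4 + l"
  show "linear (\<lambda>u. wave_tensor l (vs[i := u]))"
  proof (cases "i < 4")
    case True
    then have "(\<Prod>j\<in>{4..<4 + l}. vs[i := u] ! j $ 1) = (\<Prod>j\<in>{4..<4 + l}. vs ! j $ 1)" for u
      by (intro prod.cong) auto
    moreover have "i = 0 \<or> i = 1 \<or> i = 2 \<or> i = 3" using True by auto
    ultimately show ?thesis
      using i by (auto simp: wave_tensor_def area_form_def algebra_simps intro!: linearI)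
  next
    case False
    have "(\<Prod>j\<in>{4..<4 + l}. vs[i := u] ! j $ 1) = u $ 1 * (\<Prod>j\<in>{4..<4 + l} - {i}. vs ! j $ 1)" for u
      using False i by (subst prod.remove[of _ i]) (auto intro!: prod.cong)
    then show ?thesis
      using False by (auto simp: wave_tensor_def algebra_simps intro!: linearI)
  qed
qed

text \<open>The shift by \<open>c\<close> absorbs the summand -2 f dx^2 and so leads to the flat
  form. The scaling by \<open>s\<close> of one null coordinate is compensated by
  \<open>1 / s\<close> on the other.\<close>

definition boost :: "real \<Rightarrow> real \<Rightarrow> real ^ 3 \<Rightarrow> real ^ 3" where
  "boost c s u = vector [s * u $ 1, u $ 2, (u $ 3 - c * u $ 1) / s]"

lemma form_isometry_boost:
  "s \<noteq> 0 \<Longrightarrow> form_isometry (metric_f f p) (metric_f (\<lambda>_. 0) q) (boost (f (p $ 1, p $ 2)) s)"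
  by (intro form_isometryI inner_product_metric_f)
    (auto simp: boost_def metric_f_def field_simps vec_eq_iff forall_3 intro!: linearI)

lemma wave_tensor_boost:
  assumes "length us = 4 + l"
  shows "wave_tensor l (map (boost c s) us) = s ^ (2 + l) * wave_tensor l us"
proof -
  have "area_form (boost c s u) (boost c s v) = s * area_form u v" for u v
    by (simp add: area_form_def boost_def algebra_simps)
  moreover have "(\<Prod>i\<in>{4..<4 + l}. boost c s (us ! i) $ 1) = s ^ l * (\<Prod>i\<in>{4..<4 + l}. us ! i $ 1)"
    by (simp add: boost_def prod.distrib)
  ultimately show ?thesis using assms by (simp add: wave_tensor_def)
qed

lemma variable_curvature_homogeneous_plane_wave:
  assumes d: "\<And>l x. (d l has_real_derivative d (Suc l) x) (at x)" and pos: "\<And>l x. l \<le> k \<Longrightarrow> d l x > 0"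
  shows "variable_curvature_homogeneous k (manifold_f (plane_wave (d 0)))"
  unfolding manifold_f_eq
proof (rule variable_curvature_homogeneous_global_chartI)
  show "curvature_model k (metric_f (\<lambda>_. 0) 0) wave_tensor"
    by (simp add: curvature_model_def inner_product_metric_f multilinear_wave_tensor)
  fix p :: "real ^ 3" and l assume "l \<le> k"
  \<comment> \<open>The boost multiplies the tensor of level \<open>l\<close> by
    \<open>s ^ (2 + l)\<close>, which has to equal the coefficient at \<open>p\<close>. The model
    carries coefficient 1 at every level.\<close>
  define s where "s = root (2 + l) (d l (p $ 1))"
  have "s > 0" "s ^ (2 + l) = d l (p $ 1)"
    using pos[OF \<open>l \<le> k\<close>, of "p $ 1"] by (simp_all add: s_def real_root_gt_zero real_root_pow_pos del: power_Suc)
  then show "\<exists>L. form_isometry (metric_f (plane_wave (d 0)) p) (metric_f (\<lambda>_. 0) 0) L \<and>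
      (\<forall>us. length us = 4 + l \<longrightarrow>
        wave_tensor l (map L us) = nabla_curvature (metric_f (plane_wave (d 0))) l p us)"
    using form_isometry_boost[of s "plane_wave (d 0)" p 0]
    by (intro exI[of _ "boost (plane_wave (d 0) (p $ 1, p $ 2)) s"])
      (simp add: wave_tensor_boost nabla_curvature_plane_wave[of d, OF d] del: power_Suc)
qed

text \<open>A witness that the tensor is nonzero at every level. The second pair of vectors is
  reversed to cancel the minus sign.\<close>

lemma wave_tensor_frame:
  "wave_tensor l ([axis 1 1, axis 2 1, axis 2 1, axis 1 1] @ replicate l (axis 1 1)) = 1"
proof -
  have "(\<Prod>i\<in>{4..<4 + l}. ([axis 1 1, axis 2 1, axis 2 1, axis 1 1] @ replicate l (axis 1 (1::real))) ! i $ (1::3)) = 1"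
    by (intro prod.neutral) (auto simp: nth_append)
  then show ?thesis by (simp add: wave_tensor_def area_form_def axis_def)
qed

lemma not_variable_curvature_homogeneous_plane_wave:
  assumes d: "\<And>l x. (d l has_real_derivative d (Suc l) x) (at x)"
    and "l \<le> k" "d l x = 0" "d l y \<noteq> 0"
  shows "\<not> variable_curvature_homogeneous k (manifold_f (plane_wave (d 0)))"
proof
  define us :: "(real ^ 3) list" where
    "us = [axis 1 1, axis 2 1, axis 2 1, axis 1 1] @ replicate l (axis 1 1)"
  have us: "length us = 4 + l" "wave_tensor l us = 1"
    using wave_tensor_frame by (simp_all add: us_def)
  assume "variable_curvature_homogeneous k (manifold_f (plane_wave (d 0)))"
  then obtain L where "nabla_curvature (metric_f (plane_wave (d 0))) l (axis 1 x) (map L us) =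
    nabla_curvature (metric_f (plane_wave (d 0))) l (axis 1 y) us"
    unfolding manifold_f_eq
    by (rule variable_curvature_homogeneous_global_chartD[OF _ \<open>l \<le> k\<close>]) (use us(1) in blast)
  then show False
    using us assms(3,4) by (simp add: nabla_curvature_plane_wave[of d, OF d])
qed

lemma plane_wave_isometry_frame:
  assumes L: "form_isometry (metric_f (plane_wave a) p) (metric_f (plane_wave a) q) L"
    and y: "p $ 2 = 0" "q $ 2 = 0"
    and R: "\<And>us. length us = 4 \<Longrightarrow> c * wave_tensor 0 (map L us) = wave_tensor 0 us"
  obtains m where "m \<noteq> 0" "\<And>u. L u $ 1 = m * u $ 1"
    "area_form (L (axis 1 1)) (L (axis 2 1)) ^ 2 = m ^ 2"
proof -
  have g: "metric_f (plane_wave a) p u v = u $ 1 * v $ 3 + u $ 3 * v $ 1 + u $ 2 * v $ 2"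
    "metric_f (plane_wave a) q u v = u $ 1 * v $ 3 + u $ 3 * v $ 1 + u $ 2 * v $ 2" for u v
    using y by (simp_all add: metric_f_def plane_wave_def)
  have iso: "L u $ 1 * L v $ 3 + L u $ 3 * L v $ 1 + L u $ 2 * L v $ 2 = u $ 1 * v $ 3 + u $ 3 * v $ 1 + u $ 2 * v $ 2" for u v
    using L by (simp add: form_isometry_def g)
  have surj: "surj L" using L by (simp add: form_isometry_def bij_is_surj)
  have W: "c * (area_form (L u) (L v) * area_form (L w) (L z)) = area_form u v * area_form w z" for u v w z
    using R[of "[u, v, w, z]"] by (simp add: wave_tensor_def)
  have c: "c \<noteq> 0"
    using W[of "axis 1 1" "axis 2 1" "axis 1 1" "axis 2 1"] by (auto simp: area_form_def axis_def)
  \<comment> \<open>Repeating the same pair in both factors of the tensor yields a square, so its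
    vanishing gives the vanishing of the area form itself.\<close>
  have "area_form (L (axis 3 1)) v = 0" for v
  proof -
    obtain v' where v': "v = L v'" using surj by (metis surjD)
    have "c * (area_form (L (axis 3 1)) (L v')) ^ 2 = 0"
      using W[of "axis 3 1" v' "axis 3 1" v'] by (simp add: area_form_def axis_def power2_eq_square)
    then show ?thesis using c v' by simp
  qed
  from this[of "axis 1 1"] this[of "axis 2 1"]
  have e3: "L (axis 3 1) $ 1 = 0" "L (axis 3 1) $ 2 = 0"
    by (simp_all add: area_form_def axis_def)
  define n where "n = L (axis 3 1) $ 3"
  \<comment> \<open>The inner product with \<open>axis 3 1\<close> is dx, and
    \<open>L (axis 3 1)\<close> is \<open>n\<close> times \<open>axis 3 1\<close>.\<close>
  have n: "n * L u $ 1 = u $ 1" for u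
    using iso[of u "axis 3 1"] e3 by (simp add: n_def axis_def mult.commute)
  have n0: "n \<noteq> 0" using n[of "axis 1 1"] by (auto simp: axis_def)
  have 1: "L u $ 1 = 1 / n * u $ 1" for u using n[of u] n0 by (simp add: field_simps)
  have "L (axis 2 1) $ 1 = 0" "L (axis 1 1) $ 1 = 1 / n" by (simp_all add: 1 axis_def)
  moreover from this iso[of "axis 2 1" "axis 2 1"] have "L (axis 2 1) $ 2 ^ 2 = 1"
    by (simp add: axis_def power2_eq_square)
  ultimately have "area_form (L (axis 1 1)) (L (axis 2 1)) ^ 2 = (1 / n) ^ 2"
    by (simp add: area_form_def power_divide)
  with 1 n0 show thesis by (intro that[of "1 / n"]) auto
qed

lemma not_homothety_curvature_homogeneous_exp_plane_wave:
  "\<not> homothety_curvature_homogeneous 1 (manifold_f (plane_wave exp))"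
proof
  assume "homothety_curvature_homogeneous 1 (manifold_f (plane_wave exp))"
  \<comment> \<open>Both points have y = 0, as the frame lemma demands, and their curvature
    coefficients have ratio \<open>exp 1\<close> at both levels.\<close>
  then obtain L s t where L: "form_isometry (metric_f (plane_wave exp) 0) (metric_f (plane_wave exp) (axis 1 1)) L"
    and st: "s \<noteq> 0" "t \<noteq> 0" and R: "\<And>l us. l \<le> 1 \<Longrightarrow> length us = 4 + l \<Longrightarrow>
      t ^ (2 + l) * nabla_curvature (metric_f (plane_wave exp)) l (axis 1 1) (map L us)
      = s ^ (2 + l) * nabla_curvature (metric_f (plane_wave exp)) l 0 us"
    unfolding manifold_f_eq
    by (rule homothety_curvature_homogeneous_global_chartD[where p = 0 and q = "axis 1 1"]) blast
  have R: "t ^ (2 + l) * (exp 1 * wave_tensor l (map L us)) = s ^ (2 + l) * wave_tensor l us"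
    if "l \<le> 1" "length us = 4 + l" for l us
    using R[OF that] that nabla_curvature_plane_wave[of "\<lambda>_. exp", OF DERIV_exp] by (simp add: axis_def)
  have "t ^ 2 * exp 1 / s ^ 2 * wave_tensor 0 (map L us) = wave_tensor 0 us" if "length us = 4" for us
    using R[of 0 us] that st by (simp add: field_simps power2_eq_square)
  from plane_wave_isometry_frame[OF L _ _ this] obtain m where m: "m \<noteq> 0" "\<And>u. L u $ 1 = m * u $ 1"
    "area_form (L (axis 1 1)) (L (axis 2 1)) ^ 2 = m ^ 2" by (auto simp: axis_def)
  have sk: "area_form v u = - area_form u v" for u v by (simp add: area_form_def)
  have "t ^ 2 * exp 1 * m ^ 2 = s ^ 2"
    using R[of 0 "[axis 1 1, axis 2 1, axis 1 1, axis 2 1]"] m(3)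
    by (simp add: wave_tensor_def power2_eq_square) (simp add: area_form_def axis_def)
  moreover have "t ^ 3 * exp 1 * (m ^ 2 * m) = s ^ 3"
    using R[of 1 "[axis 1 1, axis 2 1, axis 1 1, axis 2 1, axis 1 1]"] m(2)[of "axis 1 1"] m(3)[symmetric]
    by (simp add: wave_tensor_def power2_eq_square eval_nat_numeral) (simp add: area_form_def axis_def)
  moreover have "exp 1 * (t * m / s) ^ 2 = t ^ 2 * exp 1 * m ^ 2 / s ^ 2"
    "exp 1 * (t * m / s) ^ 3 = t ^ 3 * exp 1 * (m ^ 2 * m) / s ^ 3"
    by (simp_all add: power_divide power_mult_distrib power2_eq_square power3_eq_cube)
  \<comment> \<open>For r = t m / s the two levels say e r^2 = 1 and e r^3 = 1; hence r = 1, and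
    then e = 1.\<close>
  ultimately have e: "exp 1 * (t * m / s) ^ 2 = 1" "exp 1 * (t * m / s) ^ 3 = 1"
    using st by simp_all
  then have "t * m / s = 1" by (metis (no_types, lifting) mult.assoc mult.commute mult_1 power2_eq_square power3_eq_cube)
  with e have "exp 1 = (1::real)" by simp
  then show False by simp
qed

section \<open>Local isometries of the exponential plane wave\<close>

text \<open>The defect \<open>T\<close> between the two sides is symmetric because second
  derivatives and Christoffel symbols are, and skew after differentiation of the isometry equation.
  So it vanishes for the same reason that the connection is unique.\<close>

lemma isometry_second_derivative:
  assumes a: "\<And>x. (a has_real_derivative a' x) (at x)" and U: "open U" "p \<in> U"
    and J: "\<And>x. x \<in> U \<Longrightarrow> (h has_derivative J x) (at x)"
    and H: "\<And>v. ((\<lambda>x. J x v) has_derivative H v) (at p)"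
    and iso: "\<And>x u v. x \<in> U \<Longrightarrow>
      metric_f (plane_wave a) (h x) (J x u) (J x v) = metric_f (plane_wave a) x u v"
  shows "H v w = J p (wave_connection a a' p w v) - wave_connection a a' (h p) (J p w) (J p v)"
proof -
  define g where "g = metric_f (plane_wave a)"
  define \<Gamma> where "\<Gamma> = wave_connection a a'"
  define T where "T w v = H v w + \<Gamma> (h p) (J p w) (J p v) - J p (\<Gamma> p w v)" for w v
  have g: "bilinear (g q)" "g q u v = g q v u" and nondeg: "(\<forall>v. g q u v = 0) \<Longrightarrow> u = 0" for q u v
    using inner_product_metric_f[of "plane_wave a" q] unfolding inner_product_def g_def by blast+
  have isop: "g (h p) (J p u) (J p v) = g p u v" for u v using iso[OF U(2)] by (simp add: g_def)
  have "form_isometry (g p) (g (h p)) (J p)"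
    unfolding g_def
    by (intro form_isometryI inner_product_metric_f has_derivative_linear[OF J[OF U(2)]] iso U)
  then have surj: "surj (J p)" by (simp add: form_isometry_def bij_is_surj)
  have "H v w $ i = H w v $ i" for v w i
    by (rule second_derivative_symmetric[OF U, where f = "\<lambda>x. h x $ i" and f' = "\<lambda>x w. J x w $ i"])
      (auto intro: has_derivative_nth J H)
  then have sym: "T v w = T w v" for v w
    by (simp add: T_def vec_eq_iff \<Gamma>_def wave_connection_commute[of a a' "h p" "J p v"]
        wave_connection_commute[of a a' p v])
  have skew: "g (h p) (T w u) (J p v) = - g (h p) (T w v) (J p u)" for u v w
  proof -
    have "((\<lambda>x. g (h x) (J x u) (J x v)) has_derivative
      (\<lambda>w. g (h p) (H u w + \<Gamma> (h p) (J p w) (J p u)) (J p v)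
         + g (h p) (J p u) (H v w + \<Gamma> (h p) (J p w) (J p v)))) (at p)"
      unfolding g_def \<Gamma>_def
      by (rule has_derivative_plane_wave_metric[where a = a and a' = a' and p = p and h = h and h' = "J p"
            and U = "\<lambda>x. J x u" and U' = "H u" and V = "\<lambda>x. J x v" and V' = "H v", OF a J[OF U(2)] H H])
    \<comment> \<open>By the isometry equation the pulled-back metric is \<open>g\<close> itself
      near \<open>p\<close>, so facts \<open>1\<close> and \<open>2\<close> give two derivatives of
      one function.\<close>
    then have 1: "((\<lambda>x. g x u v) has_derivative
      (\<lambda>w. g (h p) (H u w + \<Gamma> (h p) (J p w) (J p u)) (J p v)
         + g (h p) (J p u) (H v w + \<Gamma> (h p) (J p w) (J p v)))) (at p)"
      by (rule has_derivative_transform_within_open[OF _ U]) (simp add: g_def iso)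
    have 2: "((\<lambda>x. g x u v) has_derivative (\<lambda>w. g p (\<Gamma> p w u) v + g p u (\<Gamma> p w v))) (at p)"
      using has_derivative_plane_wave_metric[where a = a and a' = a' and p = p and h = "\<lambda>x. x"
          and U = "\<lambda>x. u" and V = "\<lambda>x. v", OF a has_derivative_ident has_derivative_const has_derivative_const]
      by (simp add: g_def \<Gamma>_def)
    have "g (h p) (H u w + \<Gamma> (h p) (J p w) (J p u)) (J p v)
       + g (h p) (J p u) (H v w + \<Gamma> (h p) (J p w) (J p v)) = g p (\<Gamma> p w u) v + g p u (\<Gamma> p w v)"
      using has_derivative_unique[OF 1 2] by meson
    then show ?thesis
      unfolding T_def isop[symmetric] g(2)[of "h p" "J p u"]
      by (simp add: bilinear_lsub[OF g(1)] bilinear_ladd[OF g(1)])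
  qed
  have 0: "g (h p) (T w u) (J p v) = 0" for u v w
  proof (rule symmetric_skew_form_zero[where S = "\<lambda>w u v. g (h p) (T w u) (J p v)"])
    show "g (h p) (T w u) (J p v) = g (h p) (T u w) (J p v)" for u v w
      by (subst sym) (rule refl)
  qed (rule skew)
  have "T w v = 0"
  proof (rule nondeg, rule allI)
    fix z
    obtain z' where "z = J p z'" using surj by (rule surjE)
    then show "g (h p) (T w v) z = 0" by (simp add: 0)
  qed
  then show ?thesis by (simp add: T_def \<Gamma>_def algebra_simps)
qed

lemma gradient_along_first_axis:
  fixes F G :: "real ^ 3 \<Rightarrow> real"
  assumes "open U" "p \<in> U" and "\<And>x. x \<in> U \<Longrightarrow> (F has_derivative (\<lambda>w. w $ 1 * G x)) (at x)"
    and "(G has_derivative G') (at p)"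
  shows "G' (axis 2 1) = 0"
proof -
  have "(\<lambda>v w. v $ 1 * G' w) (axis 1 1 :: real ^ 3) (axis 2 1) = (\<lambda>v w. v $ 1 * G' w) (axis 2 1 :: real ^ 3) (axis 1 1)"
    by (rule second_derivative_symmetric[where f = F and f' = "\<lambda>x w. w $ 1 * G x", OF assms(1,2,3)])
      (auto intro!: derivative_eq_intros assms(4))
  then show ?thesis by (simp add: axis_def)
qed

lemma has_derivative_wave_coefficient:
  fixes b :: "real ^ 3 \<Rightarrow> real"
  assumes "(b has_derivative (\<lambda>w. 0)) (at x)"
  shows "((\<lambda>x. exp (x $ 1) * x $ 2 * b x) has_derivative
    (\<lambda>w. exp (x $ 1) * (w $ 1 * x $ 2 + w $ 2) * b x)) (at x)"
  by (auto intro!: derivative_eq_intros assms simp: fun_eq_iff algebra_simps)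

lemma has_derivative_mult_const_square:
  fixes A B c :: "'a::real_normed_vector \<Rightarrow> real"
  assumes "(A has_derivative A') (at x)" "(B has_derivative B') (at x)" "(c has_derivative (\<lambda>w. 0)) (at x)"
  shows "((\<lambda>x. A x * B x * (c x)\<^sup>2) has_derivative (\<lambda>w. (A' w * B x + A x * B' w) * (c x)\<^sup>2)) (at x)"
  by (auto intro!: derivative_eq_intros assms simp: fun_eq_iff algebra_simps)

text \<open>The first row of the Jacobian is cleared entry by entry. \<open>J x e3 $ 1\<close> has
  zero derivative and is a factor in the dx-coefficient of d(\<open>J x e2 $ 1\<close>);
  independence of y makes it zero. The same argument then removes \<open>J x e2 $ 1\<close>. The
  surviving entry \<open>m\<close> has zero derivative, the second row gives e^x = e^(h $ 1) m^2,
  and differentiating this forces m = 1.\<close>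

lemma exp_plane_wave_isometry_preserves_first:
  assumes U: "open U" "p \<in> U"
    and J: "\<And>x. x \<in> U \<Longrightarrow> (h has_derivative J x) (at x)"
    and diff: "\<And>x v. x \<in> U \<Longrightarrow> (\<lambda>x. J x v) differentiable at x"
    and iso: "\<And>x u v. x \<in> U \<Longrightarrow>
      metric_f (plane_wave exp) (h x) (J x u) (J x v) = metric_f (plane_wave exp) x u v"
  shows "h p $ 1 = p $ 1"
proof -
  let ?\<Gamma> = "wave_connection exp exp"
  have H: "((\<lambda>x. J x v) has_derivative (\<lambda>w. J x (?\<Gamma> x w v) - ?\<Gamma> (h x) (J x w) (J x v))) (at x)"
    if x: "x \<in> U" for x v
  proof -
    have 1: "((\<lambda>x. J x v) has_derivative frechet_derivative (\<lambda>x. J x v) (at x)) (at x)" for v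
      using diff[OF x] by (simp add: frechet_derivative_works)
    have "frechet_derivative (\<lambda>x. J x v) (at x) = (\<lambda>w. J x (?\<Gamma> x w v) - ?\<Gamma> (h x) (J x w) (J x v))"
      using isometry_second_derivative[where a = exp and a' = exp and h = h and J = J and v = v
          and H = "\<lambda>v. frechet_derivative (\<lambda>x. J x v) (at x)", OF DERIV_exp U(1) x J 1 iso]
      by (intro ext)
    with 1[of v] show ?thesis by simp
  qed
  define e1 e2 e3 :: "real ^ 3" where "e1 = axis 1 1" and "e2 = axis 2 1" and "e3 = axis 3 1"
  have e: "e1 $ 1 = 1" "e1 $ 2 = 0" "e1 $ 3 = 0" "e2 $ 1 = 0" "e2 $ 2 = 1" "e2 $ 3 = 0"
    "e3 $ 1 = 0" "e3 $ 2 = 0" "e3 $ 3 = 1" by (simp_all add: e1_def e2_def e3_def axis_def)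
  have lin: "J x v $ i = v $ 1 * J x e1 $ i + v $ 2 * J x e2 $ i + v $ 3 * J x e3 $ i" if "x \<in> U" for x v i
  proof -
    interpret linear "J x" by (rule has_derivative_linear[OF J[OF that]])
    have "v = v $ 1 *\<^sub>R e1 + v $ 2 *\<^sub>R e2 + v $ 3 *\<^sub>R e3" by (simp add: vec_eq_iff forall_3 e)
    from arg_cong[OF this, of "\<lambda>v. J x v $ i"] show ?thesis by (simp add: add scale)
  qed
  have D: "((\<lambda>x. J x v $ i) has_derivative
      (\<lambda>w. J x (?\<Gamma> x w v) $ i - ?\<Gamma> (h x) (J x w) (J x v) $ i)) (at x)" if "x \<in> U" for x v i
    using has_derivative_nth[OF H[OF that]] by simp
  \<comment> \<open>The connection has no first component, so the nonlinear term at
    \<open>h x\<close> drops out of all equations for the first row.\<close>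
  have D3: "((\<lambda>x. J x e3 $ 1) has_derivative (\<lambda>w. 0)) (at x)" if "x \<in> U" for x
    using D[OF that, of e3 1] by (simp add: lin[OF that, of "?\<Gamma> _ _ _"] e)
  have D2: "((\<lambda>x. J x e2 $ 1) has_derivative (\<lambda>w. w $ 1 * (exp (x $ 1) * x $ 2 * - J x e3 $ 1))) (at x)"
    if "x \<in> U" for x
    using D[OF that, of e2 1] by (simp add: lin[OF that, of "?\<Gamma> _ _ _"] e mult_ac)
  have J3: "J x e3 $ 1 = 0" if x: "x \<in> U" for x
  proof -
    have "((\<lambda>x. - J x e3 $ 1) has_derivative (\<lambda>w. 0)) (at x)"
      using has_derivative_minus[OF D3[OF x]] by simp
    from gradient_along_first_axis[OF U(1) x D2 has_derivative_wave_coefficient[OF this]]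
    show ?thesis by (simp add: axis_def)
  qed
  have D2: "((\<lambda>x. J x e2 $ 1) has_derivative (\<lambda>w. 0)) (at x)" if "x \<in> U" for x
    using D2[OF that] J3[OF that] by simp
  have D1: "((\<lambda>x. J x e1 $ 1) has_derivative (\<lambda>w. w $ 1 * (exp (x $ 1) * x $ 2 * J x e2 $ 1))) (at x)"
    if "x \<in> U" for x
    using D[OF that, of e1 1] by (simp add: lin[OF that, of "?\<Gamma> _ _ _"] e J3[OF that] mult_ac)
  have J2: "J x e2 $ 1 = 0" if x: "x \<in> U" for x
  proof -
    from gradient_along_first_axis[OF U(1) x D1 has_derivative_wave_coefficient[OF D2[OF x]]]
    show ?thesis by (simp add: axis_def)
  qed
  define m where "m x = J x e1 $ 1" for x
  have D1: "(m has_derivative (\<lambda>w. 0)) (at x)" if "x \<in> U" for x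
    using D1[OF that] J2[OF that] by (simp add: m_def[abs_def])
  have lin1: "J x v $ 1 = v $ 1 * m x" if "x \<in> U" for x v
    using lin[OF that, of v 1] J2[OF that] J3[OF that] by (simp add: m_def)
  have K3: "J x e3 $ 2 = 0" if "x \<in> U" for x
    using iso[OF that, of e3 e3] J3[OF that] by (simp add: metric_f_def e)
  have K2: "(J x e2 $ 2)\<^sup>2 = 1" if "x \<in> U" for x
    using iso[OF that, of e2 e2] J2[OF that] by (simp add: metric_f_def e power2_eq_square)
  have DK2: "((\<lambda>x. J x e2 $ 2) has_derivative (\<lambda>w. 0)) (at x)" if "x \<in> U" for x
    using D[OF that, of e2 2] by (simp add: lin[OF that, of "?\<Gamma> _ _ _"] e K3[OF that] J2[OF that])
  let ?G = "\<lambda>x. exp (x $ 1) * x $ 2 * J x e2 $ 2 - exp (h x $ 1) * h x $ 2 * (m x)\<^sup>2"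
  have DK1: "((\<lambda>x. J x e1 $ 2) has_derivative (\<lambda>w. w $ 1 * ?G x)) (at x)" if "x \<in> U" for x
    using D[OF that, of e1 2]
    by (simp add: lin[OF that, of "?\<Gamma> _ _ _"] e K3[OF that] lin1[OF that] power2_eq_square algebra_simps)
  have Dh: "((\<lambda>x. exp (h x $ 1)) has_derivative (\<lambda>w. w $ 1 * m x * exp (h x $ 1))) (at x)"
    if "x \<in> U" for x
    using DERIV_compose_FDERIV[OF DERIV_exp has_derivative_nth[OF J[OF that], of 1]] by (simp add: lin1[OF that])
  have eq: "exp (x $ 1) = exp (h x $ 1) * (m x)\<^sup>2" if x: "x \<in> U" for x
  proof -
    from gradient_along_first_axis[OF U(1) x DK1 has_derivative_diff[OF
        has_derivative_wave_coefficient[OF DK2[OF x]]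
        has_derivative_mult_const_square[OF Dh[OF x] has_derivative_nth[OF J[OF x]] D1[OF x]]]]
    \<comment> \<open>The y-derivative of \<open>?G\<close>, which has to vanish. The factor
      \<open>J x e2 $ 2\<close> is 1 or -1 by \<open>K2\<close>.\<close>
    have "(exp (x $ 1) - exp (h x $ 1) * (m x)\<^sup>2) * J x e2 $ 2 = 0"
      by (simp add: e e2_def[symmetric] algebra_simps)
    then show ?thesis using K2[OF x] by auto
  qed
  have "((\<lambda>x. exp (h x $ 1) * (m x)\<^sup>2) has_derivative
      (\<lambda>w. w $ 1 * m p * exp (h p $ 1) * (m p)\<^sup>2)) (at p)"
    using has_derivative_mult_const_square[OF Dh[OF U(2)] has_derivative_const D1[OF U(2)], of 1] by simp
  then have 1: "((\<lambda>x. exp (x $ 1)) has_derivative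
      (\<lambda>w. w $ 1 * m p * exp (h p $ 1) * (m p)\<^sup>2)) (at p)"
    by (rule has_derivative_transform_within_open[OF _ U]) (simp add: eq)
  have 2: "((\<lambda>x. exp (x $ 1)) has_derivative (\<lambda>w. w $ 1 * exp (p $ 1))) (at p)"
    by (auto intro!: derivative_eq_intros)
  from has_derivative_unique[OF 1 2]
  have "e1 $ 1 * m p * exp (h p $ 1) * (m p)\<^sup>2 = e1 $ 1 * exp (p $ 1)" by meson
  then have "m p * exp (p $ 1) = exp (p $ 1)" using eq[OF U(2)] by (simp add: e mult_ac)
  then have "m p = 1" by simp
  then show ?thesis using eq[OF U(2)] by simp
qed

lemma not_locally_homogeneous_exp_plane_wave:
  "\<not> locally_homogeneous (manifold_f (plane_wave exp))"
proof
  assume "locally_homogeneous (manifold_f (plane_wave exp))"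
  from this[unfolded locally_homogeneous_def manifold_f_eq, rule_format, of 0 "axis 1 1"]
  obtain U h where "openin euclidean U" and U: "0 \<in> U" and h: "h 0 = axis 1 1"
    and sm: "smooth_map (manifold_f (plane_wave exp)) U h"
    and pm: "preserves_metric (manifold_f (plane_wave exp)) U h"
    unfolding manifold_f_eq global_chart_simps topspace_euclidean by blast
  then have U: "open U" "0 \<in> U" by simp_all
  have "smooth_on U h" using sm by (simp add: smooth_map_def manifold_f_eq)
  \<comment> \<open>Two derivatives of \<open>h\<close> are enough: the system expresses the
    derivative of the Jacobian through \<open>h\<close> and the Jacobian, so it can be
    differentiated once more.\<close>
  then have "Ck_on (Suc (Suc 0)) U h" unfolding smooth_on_def by blast
  then have "h differentiable_on U" "(\<lambda>x. frechet_derivative h (at x) v) differentiable_on U" for v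
    by simp_all
  then have "(h has_derivative frechet_derivative h (at x)) (at x)"
    "(\<lambda>x. frechet_derivative h (at x) v) differentiable at x" if "x \<in> U" for x v
    using that U(1) by (simp_all add: differentiable_on_eq_differentiable_at frechet_derivative_works[symmetric])
  moreover have "metric_f (plane_wave exp) (h x) (frechet_derivative h (at x) u) (frechet_derivative h (at x) v)
      = metric_f (plane_wave exp) x u v" if "x \<in> U" for x u v
    using pm that by (simp add: preserves_metric_def manifold_f_eq local_deriv_def)
  ultimately have "h 0 $ 1 = (0 :: real ^ 3) $ 1"
    by (rule exp_plane_wave_isometry_preserves_first[OF U])
  then show False by (simp add: h axis_def)
qed

section \<open>A cone metric\<close>

text \<open>With r = e^x this is dr^2 + r^2 (dy^2 + dz^2), the cone over the flat plane.\<close>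

definition cone_metric :: "(real ^ 3) metric_field" where
  "cone_metric p u v = exp (2 * p $ 1) * (u \<bullet> v)"

definition cone_tensor :: "(real ^ 3) tensor" where
  "cone_tensor vs = (vs ! 0 $ 2 * vs ! 1 $ 3 - vs ! 0 $ 3 * vs ! 1 $ 2)
     * (vs ! 2 $ 2 * vs ! 3 $ 3 - vs ! 2 $ 3 * vs ! 3 $ 2)"

lemma inner_product_cone_metric: "inner_product (cone_metric p)"
proof -
  have "u = 0" if "\<forall>v. cone_metric p u v = 0" for u
    using that[rule_format, of u] by (simp add: cone_metric_def)
  moreover have "bilinear (cone_metric p)"
    by (auto simp: bilinear_def cone_metric_def inner_add_left inner_add_right algebra_simps intro!: linearI)
  ultimately show ?thesis by (auto simp: inner_product_def cone_metric_def inner_commute)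
qed

text \<open>The formula for a conformal change e^(2 phi) of a flat metric. Its coefficients are
  constant because phi = x is linear.\<close>

lemma levi_civita_cone:
  "levi_civita cone_metric = (\<lambda>_ u v. u $ 1 *\<^sub>R v + v $ 1 *\<^sub>R u - (u \<bullet> v) *\<^sub>R axis 1 1)"
proof (rule ext, rule levi_civita_eqI[OF inner_product_cone_metric])
  show "bilinear (\<lambda>u v :: real ^ 3. u $ 1 *\<^sub>R v + v $ 1 *\<^sub>R u - (u \<bullet> v) *\<^sub>R axis 1 1)"
    by (auto simp: bilinear_def inner_add_left inner_add_right algebra_simps intro!: linearI)
  fix p u v :: "real ^ 3"
  show "u $ 1 *\<^sub>R v + v $ 1 *\<^sub>R u - (u \<bullet> v) *\<^sub>R axis 1 1 = v $ 1 *\<^sub>R u + u $ 1 *\<^sub>R v - (v \<bullet> u) *\<^sub>R axis 1 1"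
    by (simp add: inner_commute)
  have "((\<lambda>y. cone_metric y u v) has_derivative (\<lambda>w. 2 * w $ 1 * exp (2 * p $ 1) * (u \<bullet> v))) (at p)"
    unfolding cone_metric_def by (auto intro!: derivative_eq_intros)
  moreover have "2 * w $ 1 * exp (2 * p $ 1) * (u \<bullet> v) =
      cone_metric p (w $ 1 *\<^sub>R u + u $ 1 *\<^sub>R w - (w \<bullet> u) *\<^sub>R axis 1 1) v
      + cone_metric p u (w $ 1 *\<^sub>R v + v $ 1 *\<^sub>R w - (w \<bullet> v) *\<^sub>R axis 1 1)" for w
    by (simp add: cone_metric_def inner_vec_def sum_3 axis_def algebra_simps)
  ultimately show "((\<lambda>y. cone_metric y u v) has_derivative
      (\<lambda>w. cone_metric p (w $ 1 *\<^sub>R u + u $ 1 *\<^sub>R w - (w \<bullet> u) *\<^sub>R axis 1 1) v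
      + cone_metric p u (w $ 1 *\<^sub>R v + v $ 1 *\<^sub>R w - (w \<bullet> v) *\<^sub>R axis 1 1))) (at p)"
    by simp
qed

lemma nabla_curvature_cone: "nabla_curvature cone_metric 0 p vs = exp (2 * p $ 1) * cone_tensor vs"
  using frechet_derivative_at[OF has_derivative_const, symmetric]
  by (simp add: curvature_tensor_def curvature_operator_def Let_def levi_civita_cone cone_tensor_def)
    (simp add: cone_metric_def inner_vec_def sum_3 axis_def algebra_simps)

lemma homothety_curvature_homogeneous_cone:
  "homothety_curvature_homogeneous 0 (global_chart cone_metric)"
proof (rule homothety_curvature_homogeneous_global_chartI)
  have "linear (\<lambda>u. cone_tensor (vs[i := u]))" if "length vs = 4" "i < 4" for vs and i :: nat
  proof -
    have "i = 0 \<or> i = 1 \<or> i = 2 \<or> i = 3" using that by auto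
    then show ?thesis
      using that by (auto simp: cone_tensor_def algebra_simps intro!: linearI)
  qed
  then show "curvature_model 0 (cone_metric 0) (\<lambda>_. cone_tensor)"
    by (simp add: curvature_model_def inner_product_cone_metric multilinear_form_def)
  fix p :: "real ^ 3"
  have ee: "exp (2 * p $ 1) = exp (p $ 1) * exp (p $ 1)" by (simp flip: exp_add)
  \<comment> \<open>Dilation by e^x multiplies a tensor of rank 4 by e^(4 x), which is s^2 times the
    coefficient e^(2 x) for s = e^x. One number serves as dilation and as scaling factor.\<close>
  have "form_isometry (cone_metric p) (cone_metric 0) ((*\<^sub>R) (exp (p $ 1)))"
    by (intro form_isometryI inner_product_cone_metric bounded_linear.linear[OF bounded_linear_scaleR_right])
      (simp add: cone_metric_def ee mult.assoc)
  moreover have "cone_tensor (map ((*\<^sub>R) (exp (p $ 1))) us) = exp (p $ 1) ^ 2 * (exp (2 * p $ 1) * cone_tensor us)"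
    if "length us = 4" for us
    using that unfolding ee by (simp add: cone_tensor_def power2_eq_square algebra_simps)
  ultimately show "\<exists>L s. form_isometry (cone_metric p) (cone_metric 0) L \<and> s \<noteq> 0 \<and> (\<forall>l\<le>0. \<forall>us. length us = 4 + l \<longrightarrow>
      cone_tensor (map L us) = s ^ (2 + l) * nabla_curvature cone_metric l p us)"
    by (intro exI[of _ "(*\<^sub>R) (exp (p $ 1))"] exI[of _ "exp (p $ 1)"])
      (simp add: nabla_curvature_cone del: nabla_curvature.simps)
qed

text \<open>The left side is one squared component of the bivector of u and v, which is bounded by
  the product of the squared lengths; the difference is an explicit sum of squares. Since the image
  of a plane under an isometry is unknown, a bound over all planes is needed.\<close>

lemma cone_tensor_le: "cone_tensor [u, v, u, v] \<le> (u \<bullet> u) * (v \<bullet> v)"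
proof -
  have "(u \<bullet> u) * (v \<bullet> v) - cone_tensor [u, v, u, v] = (u $ 2 * v $ 2 + u $ 3 * v $ 3)\<^sup>2 + (u $ 1 * v $ 1)\<^sup>2
      + (u $ 1 * v $ 2)\<^sup>2 + (u $ 1 * v $ 3)\<^sup>2 + (u $ 2 * v $ 1)\<^sup>2 + (u $ 3 * v $ 1)\<^sup>2"
    by (simp add: cone_tensor_def inner_vec_def sum_3 power2_eq_square algebra_simps)
  also have "\<dots> \<ge> 0" by simp
  finally show ?thesis by simp
qed

text \<open>The sectional curvature of the plane \<open>dx = 0\<close> is proportional to \<open>exp (- 2 x)\<close>.\<close>

lemma not_variable_curvature_homogeneous_cone:
  "\<not> variable_curvature_homogeneous 0 (global_chart cone_metric)"
proof
  assume "variable_curvature_homogeneous 0 (global_chart cone_metric)"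
  then obtain L where L: "form_isometry (cone_metric 0) (cone_metric (axis 1 1)) L"
    "\<And>us. length us = 4 + 0 \<Longrightarrow>
      nabla_curvature cone_metric 0 (axis 1 1) (map L us) = nabla_curvature cone_metric 0 0 us"
    by (rule variable_curvature_homogeneous_global_chartD[OF _ order_refl]) blast
  have i: "exp 2 * (L u \<bullet> L u) = u \<bullet> u" for u
    using L(1) by (simp add: form_isometry_def cone_metric_def axis_def)
  define u v :: "real ^ 3" where "u = axis 2 1" and "v = axis 3 1"
  \<comment> \<open>\<open>L\<close> divides squared lengths by e^2 and the coefficient at the
    target is e^2, so the bound allows at most e^(-2) where the source has 1.\<close>
  have "1 = exp 2 * cone_tensor [L u, L v, L u, L v]"
    using L(2)[of "[u, v, u, v]"] unfolding nabla_curvature_cone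
    by (simp add: cone_tensor_def u_def v_def axis_def)
  also have "\<dots> \<le> exp 2 * ((L u \<bullet> L u) * (L v \<bullet> L v))"
    using cone_tensor_le by simp
  also have "\<dots> = L v \<bullet> L v"
    using i[of u] by (simp add: u_def inner_axis_axis flip: mult.assoc)
  finally have "exp 2 * 1 \<le> exp 2 * (L v \<bullet> L v)" by simp
  also have "\<dots> = 1" using i[of v] by (simp add: v_def inner_axis_axis)
  finally show False by simp
qed

section \<open>The implications and the separating examples\<close>

lemma curvature_homogeneous_imp_homothety:
  "curvature_homogeneous k M \<Longrightarrow> homothety_curvature_homogeneous k M"
  unfolding curvature_homogeneous_def homothety_curvature_homogeneous_def
  by (metis power_one zero_neq_one)

lemma homothety_imp_variable_homothety:
  "homothety_curvature_homogeneous k M \<Longrightarrow> variable_homothety_curvature_homogeneous k M"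
  unfolding homothety_curvature_homogeneous_def variable_homothety_curvature_homogeneous_def
  by meson

lemma curvature_homogeneous_imp_variable:
  "curvature_homogeneous k M \<Longrightarrow> variable_curvature_homogeneous k M"
  unfolding curvature_homogeneous_def variable_curvature_homogeneous_def by meson

lemma variable_imp_variable_homothety:
  "variable_curvature_homogeneous k M \<Longrightarrow> variable_homothety_curvature_homogeneous k M"
  unfolding variable_curvature_homogeneous_def variable_homothety_curvature_homogeneous_def
  by (metis power_one zero_neq_one)

lemma smooth_on_nth: "smooth_on UNIV (\<lambda>p :: real ^ 'n. p $ i)"
  by (rule smooth_on_bounded_linear[OF bounded_linear_vec_nth])

lemma pseudo_riemannian_exp_plane_wave: "pseudo_riemannian_manifold (manifold_f (plane_wave exp))"
  unfolding manifold_f_eq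
proof (rule pseudo_riemannian_global_chart)
  show "smooth_on UNIV (id :: real ^ 3 \<Rightarrow> real ^ 3)"
    unfolding id_def by (intro smooth_on_bounded_linear bounded_linear_ident)
  show "smooth_on UNIV (\<lambda>x. metric_f (plane_wave exp) x u v)" for u v
    unfolding metric_f_simp plane_wave_def prod.case power2_eq_square
    by (intro smooth_on_add smooth_on_mult smooth_on_const smooth_on_nth
        smooth_on_exp bounded_linear_vec_nth)
qed (rule inner_product_metric_f)

lemma pseudo_riemannian_cone: "pseudo_riemannian_manifold (global_chart cone_metric)"
proof (rule pseudo_riemannian_global_chart)
  show "smooth_on UNIV (id :: real ^ 3 \<Rightarrow> real ^ 3)"
    unfolding id_def by (intro smooth_on_bounded_linear bounded_linear_ident)
  show "smooth_on UNIV (\<lambda>x. cone_metric x u v)" for u v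
    unfolding cone_metric_def
    by (intro smooth_on_mult smooth_on_const smooth_on_exp bounded_linear_const_mult bounded_linear_vec_nth)
qed (rule inner_product_cone_metric)

section \<open>Plane waves that are homogeneous up to exactly a given level\<close>

lemma exists_variable_curvature_homogeneous_exactly:
  assumes "k \<ge> 1"
  shows "\<exists>f. smooth_on UNIV f \<and> variable_curvature_homogeneous k (manifold_f f) \<and>
    \<not> variable_curvature_homogeneous (k + 1) (manifold_f f)"
proof -
  \<comment> \<open>The \<open>l\<close>-th derivative is \<open>exp x\<close> times a quadratic polynomial in \<open>exp x\<close>; \<open>c\<close> is chosen so that
    its discriminant is negative for \<open>l \<le> k\<close> and zero for \<open>l = k + 1\<close>.\<close>
  define c :: real where "c = 4 ^ k / 3 ^ Suc k"
  define d :: "nat \<Rightarrow> real \<Rightarrow> real" where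
    "d l x = exp x - 2 ^ l * exp (2 * x) + c * 3 ^ l * exp (3 * x)" for l x
  have D: "(d l has_real_derivative d (Suc l) x) (at x)" for l x
    unfolding d_def by (auto intro!: derivative_eq_intros)
  have d: "d l x = exp x * (1 - 2 ^ l * exp x + c * 3 ^ l * (exp x)\<^sup>2)" for l x
  proof -
    have "exp (2 * x) = exp x ^ 2" "exp (3 * x) = exp x ^ 3"
      using exp_of_nat_mult[of 2 x] exp_of_nat_mult[of 3 x] by simp_all
    then show ?thesis by (simp add: d_def algebra_simps power2_eq_square power3_eq_cube)
  qed
  have pos: "d l x > 0" if "l \<le> k" for l x
  proof -
    define A where "A = c * 3 ^ l"
    \<comment> \<open>Since 4 c = (4/3)^(k+1), the discriminant 4^l - 4 c 3^l is negative exactly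
      when (4/3)^l < (4/3)^(k+1).\<close>
    have "(4 / 3 :: real) ^ l < (4 / 3) ^ Suc k"
      using that by (intro power_strict_increasing) auto
    moreover have "(2 ^ l)\<^sup>2 = (4 :: real) ^ l"
      by (simp add: power2_eq_square flip: power_mult_distrib)
    ultimately have A: "(2 ^ l)\<^sup>2 < 4 * A"
      by (simp add: A_def c_def power_divide field_simps)
    have "A > 0" by (simp add: A_def c_def)
    have "4 * A * (1 - 2 ^ l * exp x + A * (exp x)\<^sup>2) = (2 * A * exp x - 2 ^ l)\<^sup>2 + (4 * A - (2 ^ l)\<^sup>2)"
      by (simp add: power2_eq_square algebra_simps)
    also have "\<dots> > 0" using A by (intro add_nonneg_pos) auto
    finally have "1 - 2 ^ l * exp x + A * (exp x)\<^sup>2 > 0"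
      using \<open>A > 0\<close> by (simp add: zero_less_mult_iff)
    then show ?thesis by (simp add: d A_def)
  qed
  have d': "d (k + 1) x = exp x * (1 - 2 ^ k * exp x)\<^sup>2" for x
  proof -
    have "(2 ^ k)\<^sup>2 = (4 :: real) ^ k"
      by (simp add: power2_eq_square flip: power_mult_distrib)
    then have "c * 3 ^ (k + 1) = (2 ^ k)\<^sup>2" by (simp add: c_def)
    then show ?thesis unfolding d by (simp add: power2_eq_square algebra_simps)
  qed
  have "smooth_on UNIV (plane_wave (d 0))"
    unfolding plane_wave_def d_def case_prod_beta power2_eq_square diff_conv_add_uminus mult_minus_left[symmetric]
    by (intro smooth_on_add smooth_on_mult smooth_on_const smooth_on_exp smooth_on_bounded_linear
        bounded_linear_const_mult bounded_linear_fst bounded_linear_snd)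
  moreover have "d (k + 1) (ln (1 / 2 ^ k)) = 0" unfolding d' by (subst exp_ln) simp_all
  \<comment> \<open>The only zero of the coefficient of level k + 1 lies at e^x = 2^(-k); for
    positive k this is not x = 0, so the coefficient is nonzero there.\<close>
  moreover have "(2::real) ^ k > 1" using assms by (intro one_less_power) auto
  then have "d (k + 1) 0 \<noteq> 0" unfolding d' by simp
  ultimately show ?thesis
    using variable_curvature_homogeneous_plane_wave[where d = d, OF D pos]
      not_variable_curvature_homogeneous_plane_wave[where d = d, OF D order_refl] by blast
qed

theorem theorem1p11:
  shows
    "(\<forall>k\<ge>1. \<exists>f. smooth_on UNIV f \<and>
        variable_curvature_homogeneous k (manifold_f f) \<and>
        \<not> variable_curvature_homogeneous (k + 1) (manifold_f f))
     \<and>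
     ((\<forall>k. variable_curvature_homogeneous k (manifold_f (\<lambda>(x, y). 1 / 2 * exp x * y ^ 2))) \<and>
      \<not> homothety_curvature_homogeneous 1 (manifold_f (\<lambda>(x, y). 1 / 2 * exp x * y ^ 2)) \<and>
      \<not> locally_homogeneous (manifold_f (\<lambda>(x, y). 1 / 2 * exp x * y ^ 2)))
     \<and>
     (\<forall>(M :: ('a, 'v::euclidean_space) prm) k.
        pseudo_riemannian_manifold M \<and> DIM('v) \<ge> 3 \<longrightarrow>
        (curvature_homogeneous k M \<longrightarrow> homothety_curvature_homogeneous k M) \<and>
        (homothety_curvature_homogeneous k M \<longrightarrow> variable_homothety_curvature_homogeneous k M) \<and>
        (curvature_homogeneous k M \<longrightarrow> variable_curvature_homogeneous k M) \<and>
        (variable_curvature_homogeneous k M \<longrightarrow> variable_homothety_curvature_homogeneous k M))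
     \<and>
     (\<not> (\<forall>(M :: (real ^ 3, real ^ 3) prm) k. pseudo_riemannian_manifold M \<longrightarrow>
          homothety_curvature_homogeneous k M \<longrightarrow> curvature_homogeneous k M) \<and>
      \<not> (\<forall>(M :: (real ^ 3, real ^ 3) prm) k. pseudo_riemannian_manifold M \<longrightarrow>
          variable_curvature_homogeneous k M \<longrightarrow> curvature_homogeneous k M) \<and>
      \<not> (\<forall>(M :: (real ^ 3, real ^ 3) prm) k. pseudo_riemannian_manifold M \<longrightarrow>
          variable_homothety_curvature_homogeneous k M \<longrightarrow> curvature_homogeneous k M) \<and>
      \<not> (\<forall>(M :: (real ^ 3, real ^ 3) prm) k. pseudo_riemannian_manifold M \<longrightarrow>
          variable_curvature_homogeneous k M \<longrightarrow> homothety_curvature_homogeneous k M) \<and>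
      \<not> (\<forall>(M :: (real ^ 3, real ^ 3) prm) k. pseudo_riemannian_manifold M \<longrightarrow>
          variable_homothety_curvature_homogeneous k M \<longrightarrow> homothety_curvature_homogeneous k M) \<and>
      \<not> (\<forall>(M :: (real ^ 3, real ^ 3) prm) k. pseudo_riemannian_manifold M \<longrightarrow>
          homothety_curvature_homogeneous k M \<longrightarrow> variable_curvature_homogeneous k M) \<and>
      \<not> (\<forall>(M :: (real ^ 3, real ^ 3) prm) k. pseudo_riemannian_manifold M \<longrightarrow>
          variable_homothety_curvature_homogeneous k M \<longrightarrow> variable_curvature_homogeneous k M))"
proof -
  have wave: "(\<lambda>(x, y). 1 / 2 * exp x * y ^ 2) = plane_wave exp" by (simp add: plane_wave_def)
  have var: "variable_curvature_homogeneous k (manifold_f (plane_wave exp))" for k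
    using variable_curvature_homogeneous_plane_wave[where d = "\<lambda>_. exp", OF DERIV_exp] by simp
  \<comment> \<open>Two examples settle all seven cases through the valid implications: the
    exponential wave has (2a) without (1b), hence also (2b) without (1a); the cone has (1b) without
    (2a), hence also (1b) without (1a) and (2b) without (2a).\<close>
  note facts = var pseudo_riemannian_exp_plane_wave not_homothety_curvature_homogeneous_exp_plane_wave
    pseudo_riemannian_cone homothety_curvature_homogeneous_cone not_variable_curvature_homogeneous_cone
  note implications = curvature_homogeneous_imp_homothety homothety_imp_variable_homothety
    curvature_homogeneous_imp_variable variable_imp_variable_homothety
  show ?thesis unfolding wave
  proof (intro conjI allI impI, goal_cases)
    case 1
    then show ?case by (rule exists_variable_curvature_homogeneous_exactly)
  next
    case 4
    show ?case by (rule not_locally_homogeneous_exp_plane_wave)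
  qed (use facts implications in blast)+
qed

end
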